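(* Let $\mathscr G_1\subset\mathcal F$ be a convex, bounded, closed, balanced set with $0\in\mathrm{int}\,\mathscr G_1$, and suppose that the unknown $\varphi\in\mathscr D(L)$ satisfies $L\varphi\in\mathscr G_1$ and that the noise satisfies $\eta\in\{\eta: M(\eta,\eta)\le 1\}$. For given $\ell\in\mathcal H$ put $\mathcal U_\ell=\{u\in\mathcal Y:\ \ell-H^*u\in R(L^* )\}$. Then the minimax error $\hat\sigma(\ell)$ is finite if and only if $\ell-H^*u\in R(L^* )$ for some $u\in\mathcal Y$. Under this condition there exists a unique minimax estimation $\hat u\in\mathcal U_\ell$, and $$\sigma(\ell,\hat u)=\min_u\sigma(\ell,u),\qquad \sigma(\ell,u)=(u,u)+\min_z\{c^2(\mathscr G_1,z):\ L^*z=\ell-H^*u\}.$$ If $R(L)$ and $H(N(L))$ are closed sets, then $\hat u$ is determined by the following conditions: $$\hat u-Hp_0\in H\bigl(\partial I_2(H^*\hat u)\bigr),\qquad Lp_0=0,$$ where $$I_2(w)=\min_z\{c^2(\mathscr G_1,z):\ L^*z=P_{L^*}(\ell-w)\}.$$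
   Context: $\mathcal H,\mathcal F,\mathcal Y$ are Hilbert spaces, with inner products denoted $(\cdot,\cdot)$. $L:\mathcal H\to\mathcal F$ is a closed linear operator whose domain $\mathscr D(L)$ is dense in $\mathcal H$; $H\in\mathscr L(\mathcal H,\mathcal Y)$ is a bounded linear operator. $L^*$, with domain $\mathscr D(L^* )$, and $H^*$ are the adjoints; minima over $z$ are over $z\in\mathscr D(L^* )$ satisfying the indicated equation (equal to $+\infty$ if there is no such $z$). $N(L)=\{\varphi\in\mathscr D(L):L\varphi=0\}$, $R(\cdot)$ denotes the range, $P_{L^*}$ is the orthogonal projector onto $R(L^* )$, $\partial f(x)$ is the subdifferential of $f$ at $x$, and $c(\mathscr G_1,z)=\sup\{(z,f):f\in\mathscr G_1\}$, $c^2(\mathscr G_1,z)=(c(\mathscr G_1,z))^2$. Balanced means $\lambda\mathscr G_1\subset\mathscr G_1$ for $|\lambda|\le1$. In the optimality condition, $p_0$ is an element of $\mathscr D(L)$. One observes $y=H\varphi+\eta$, where $\eta$ is a random $\mathcal Y$-valued vector with zero mean; $M$ denotes mathematical expectation. For $\ell\in\mathcal H$, the quantity $(\ell,\varphi)$ is estimated by $(u,y)+c$ with $u\in\mathcal Y$, $c\in\mathbb R$. Put $$\sigma(\ell,u)=\inf_{c\in\mathbb R}\ \sup_{\varphi,\eta}M\bigl((\ell,\varphi)-(u,y)-c\bigr)^2,$$ where the supremum is over all $\varphi\in\mathscr D(L)$ with $L\varphi\in\mathscr G_1$ and all admissible noises $\eta$. The minimax (a priori mean-squared) error in the direction $\ell$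 is $\hat\sigma(\ell)=(\inf_u\sigma(\ell,u))^{1/2}$. A minimax estimation is a minimizer $\hat u$ of $\sigma(\ell,\cdot)$.
   Formalization: The printed optimality condition is false (all spaces the reals, L=H=identity, G1=[-1,1], l=1: the minimiser is 1/2 but the subdifferential of I2 there is {-1}); it is replaced by -2(û-Hp0) ∈ H(∂I2(H*û)), Lp0=0, which characterizes û among u in U_l. *)

theory Defs
  imports "HOL-Probability.Probability"
begin

text \<open>
  An unbounded operator is given by its domain \<open>D\<close> together with a total function \<open>L\<close>; the
  values of \<open>L\<close> outside \<open>D\<close> play no role, so the range is \<open>L ` D\<close>.
\<close>

definition linear_operator_on ::
    "'h::real_vector set \<Rightarrow> ('h \<Rightarrow> 'f::real_vector) \<Rightarrow> bool" where
  "linear_operator_on D L \<longleftrightarrow> subspace D \<and>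
     (\<forall>x\<in>D. \<forall>y\<in>D. L (x + y) = L x + L y) \<and>
     (\<forall>a. \<forall>x\<in>D. L (a *\<^sub>R x) = a *\<^sub>R L x)"

definition closed_operator_on ::
    "'h::real_normed_vector set \<Rightarrow> ('h \<Rightarrow> 'f::real_normed_vector) \<Rightarrow> bool" where
  "closed_operator_on D L \<longleftrightarrow> linear_operator_on D L \<and> closed ((\<lambda>x. (x, L x)) ` D)"

definition null_space :: "'h set \<Rightarrow> ('h \<Rightarrow> 'f::zero) \<Rightarrow> 'h set" where
  "null_space D L = {\<phi> \<in> D. L \<phi> = 0}"

definition adj_dom :: "'h::real_inner set \<Rightarrow> ('h \<Rightarrow> 'f::real_inner) \<Rightarrow> 'f set" where
  "adj_dom D L = {z. \<exists>w. \<forall>\<phi>\<in>D. L \<phi> \<bullet> z = \<phi> \<bullet> w}"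

text \<open>Uniquely determined on \<open>adj_dom D L\<close> when \<open>D\<close> is dense.\<close>

definition adj_op :: "'h::real_inner set \<Rightarrow> ('h \<Rightarrow> 'f::real_inner) \<Rightarrow> 'f \<Rightarrow> 'h" where
  "adj_op D L z = (THE w. \<forall>\<phi>\<in>D. L \<phi> \<bullet> z = \<phi> \<bullet> w)"

definition adj_range :: "'h::real_inner set \<Rightarrow> ('h \<Rightarrow> 'f::real_inner) \<Rightarrow> 'h set" where
  "adj_range D L = adj_op D L ` adj_dom D L"

text \<open>Meaningful for closed subspaces \<open>S\<close> of a complete space.\<close>

definition orth_proj :: "'h::real_inner set \<Rightarrow> 'h \<Rightarrow> 'h" where
  "orth_proj S x = (THE p. p \<in> S \<and> (\<forall>s\<in>S. orthogonal (x - p) s))"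

definition balanced :: "'f::real_vector set \<Rightarrow> bool" where
  "balanced G \<longleftrightarrow> (\<forall>t::real. \<bar>t\<bar> \<le> 1 \<longrightarrow> (\<lambda>x. t *\<^sub>R x) ` G \<subseteq> G)"

definition support_fun :: "'f::real_inner set \<Rightarrow> 'f \<Rightarrow> real" where
  "support_fun G z = (SUP f\<in>G. z \<bullet> f)"

definition subdifferential :: "('h::real_inner \<Rightarrow> ereal) \<Rightarrow> 'h \<Rightarrow> 'h set" where
  "subdifferential f x =
     {q. \<bar>f x\<bar> \<noteq> \<infinity> \<and> (\<forall>y. f x + ereal (q \<bullet> (y - x)) \<le> f y)}"

text \<open>The infimum over the empty set is \<open>\<infinity>\<close>.\<close>

definition min_support_sq ::
    "'h::real_inner set \<Rightarrow> ('h \<Rightarrow> 'f::real_inner) \<Rightarrow> 'f set \<Rightarrow> 'h \<Rightarrow> ereal" where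
  "min_support_sq D L G w =
     (INF z \<in> {z \<in> adj_dom D L. adj_op D L z = w}. ereal ((support_fun G z)\<^sup>2))"

definition I2 ::
    "'h::real_inner set \<Rightarrow> ('h \<Rightarrow> 'f::real_inner) \<Rightarrow> 'f set \<Rightarrow> 'h \<Rightarrow> 'h \<Rightarrow> ereal" where
  "I2 D L G l w = min_support_sq D L G (orth_proj (adj_range D L) (l - w))"

text \<open>
  The mean of a noise vector is taken in the weak sense, so that no separability of the
  observation space is needed; each \<open>v \<bullet> \<eta>\<close> is integrable because \<open>\<eta> \<bullet> \<eta>\<close> is.
\<close>

definition admissible_noise :: "'w measure \<Rightarrow> ('w \<Rightarrow> 'y::real_inner) \<Rightarrow> bool" where
  "admissible_noise \<Omega> \<eta> \<longleftrightarrow> prob_space \<Omega> \<and> \<eta> \<in> borel_measurable \<Omega> \<and>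
     (\<forall>v. prob_space.expectation \<Omega> (\<lambda>\<omega>. v \<bullet> \<eta> \<omega>) = 0) \<and>
     integrable \<Omega> (\<lambda>\<omega>. \<eta> \<omega> \<bullet> \<eta> \<omega>) \<and>
     prob_space.expectation \<Omega> (\<lambda>\<omega>. \<eta> \<omega> \<bullet> \<eta> \<omega>) \<le> 1"

text \<open>
  The noise ranges over random vectors on arbitrary probability spaces with sample points of
  type \<open>'y\<close>. This is no restriction: the expectations depend only on the law of \<open>\<eta>\<close>, and every
  law on \<open>'y\<close> is realised by the identity on the probability space given by that law.
\<close>

definition worst_mse ::
    "'h::real_inner set \<Rightarrow> ('h \<Rightarrow> 'f::real_inner) \<Rightarrow> ('h \<Rightarrow> 'y::real_inner) \<Rightarrow> 'f set \<Rightarrow>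
     'h \<Rightarrow> 'y \<Rightarrow> real \<Rightarrow> ereal" where
  "worst_mse D L H G l u c =
     (SUP (\<phi>, \<Omega>, \<eta>) \<in> {(\<phi>, \<Omega> :: 'y measure, \<eta>). \<phi> \<in> D \<and> L \<phi> \<in> G \<and> admissible_noise \<Omega> \<eta>}.
        ereal (prob_space.expectation \<Omega> (\<lambda>\<omega>. (l \<bullet> \<phi> - u \<bullet> (H \<phi> + \<eta> \<omega>) - c)\<^sup>2)))"

definition sigma_err ::
    "'h::real_inner set \<Rightarrow> ('h \<Rightarrow> 'f::real_inner) \<Rightarrow> ('h \<Rightarrow> 'y::real_inner) \<Rightarrow> 'f set \<Rightarrow>
     'h \<Rightarrow> 'y \<Rightarrow> ereal" where
  "sigma_err D L H G l u = (INF c. worst_mse D L H G l u c)"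

definition minimax_error ::
    "'h::real_inner set \<Rightarrow> ('h \<Rightarrow> 'f::real_inner) \<Rightarrow> ('h \<Rightarrow> 'y::real_inner) \<Rightarrow> 'f set \<Rightarrow>
     'h \<Rightarrow> ereal" where
  "minimax_error D L H G l =
     (let s = (INF u. sigma_err D L H G l u)
      in if s = \<infinity> then \<infinity> else ereal (sqrt (real_of_ereal s)))"

definition minimax_estimation ::
    "'h::real_inner set \<Rightarrow> ('h \<Rightarrow> 'f::real_inner) \<Rightarrow> ('h \<Rightarrow> 'y::real_inner) \<Rightarrow> 'f set \<Rightarrow>
     'h \<Rightarrow> 'y \<Rightarrow> bool" where
  "minimax_estimation D L H G l u \<longleftrightarrow> is_arg_min (sigma_err D L H G l) (\<lambda>_. True) u"

definition admissible_weights ::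
    "'h::real_inner set \<Rightarrow> ('h \<Rightarrow> 'f::real_inner) \<Rightarrow> ('h \<Rightarrow> 'y::real_inner) \<Rightarrow> 'h \<Rightarrow> 'y set"
  where
  "admissible_weights D L H l = {u. l - adjoint H u \<in> adj_range D L}"

text \<open>
  First-order condition for minimising \<open>(u,u) + I2 (H* u)\<close> over \<open>admissible_weights\<close>, namely
  \<open>0 \<in> 2 u + H (\<partial> I2 (H* u)) + H (N L)\<close>; the gradient \<open>2 u\<close> is the source of the factor \<open>- 2\<close>,
  and \<open>p\<^sub>0\<close> is the element of \<open>N L\<close> rescaled. The condition \<open>u - H p\<^sub>0 \<in> H (\<partial> I2 (H* u))\<close> found in
  the literature omits this factor and is not correct: for identity operators on the reals and
  \<open>G = {-1..1}\<close> the minimiser is \<open>l / 2\<close>, while \<open>\<partial> I2 (u) = {2 (u - l)}\<close>, so it would give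
  \<open>u = 2 l\<close>.
\<close>

definition optimality_condition ::
    "'h::real_inner set \<Rightarrow> ('h \<Rightarrow> 'f::real_inner) \<Rightarrow> ('h \<Rightarrow> 'y::real_inner) \<Rightarrow> 'f set \<Rightarrow>
     'h \<Rightarrow> 'y \<Rightarrow> 'h \<Rightarrow> bool" where
  "optimality_condition D L H G l u p\<^sub>0 \<longleftrightarrow> p\<^sub>0 \<in> D \<and> L p\<^sub>0 = 0 \<and>
     - 2 *\<^sub>R (u - H p\<^sub>0) \<in> H ` subdifferential (I2 D L G l) (adjoint H u)"

end

theory Submission
  imports Defs
begin

text \<open>
  By symmetry of \<open>G\<close> the best constant is \<open>c = 0\<close>, and two-point noise along \<open>u\<close> is the worst, so
  that \<open>\<sigma>(l,u)\<close> is \<open>u \<bullet> u\<close> plus the supremum of the squares of \<open>(l - H* u) \<bullet> \<phi>\<close> over all \<open>\<phi>\<close> with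
  \<open>L \<phi> \<in> G\<close>. A bound \<open>S\<close> on \<open>w \<bullet> \<phi>\<close> over these \<open>\<phi>\<close> says that the functional \<open>L \<phi> \<mapsto> w \<bullet> \<phi>\<close> on
  the range of \<open>L\<close> is at most \<open>S\<close> on \<open>G\<close>; Hahn-Banach extends it to some \<open>z\<close> with \<open>L* z = w\<close> and
  support function at most \<open>S\<close>. This gives the duality formula, the attainment of the minimum over
  \<open>z\<close>, and the criterion for finiteness. Sublevel sets of the strongly convex function \<open>\<sigma>(l,\<cdot>)\<close> are
  closed, convex and bounded, hence there is exactly one minimiser.

  If the range of \<open>L\<close> is closed, the open mapping argument makes the range of \<open>L*\<close> the orthogonal
  complement of \<open>N L\<close> and \<open>I2\<close> finite and continuous. Minimality of \<open>u\<close> in the directions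
  \<open>v \<bottom> H (N L)\<close> says that \<open>H* v \<mapsto> - 2 (u \<bullet> v)\<close> lies below the increments of \<open>I2\<close> at \<open>H* u\<close>;
  Hahn-Banach extends this functional to a subgradient \<open>q\<close>, and \<open>H q + 2 u\<close> is orthogonal to
  all such \<open>v\<close>, hence belongs to the closed subspace \<open>H (N L)\<close>.
\<close>

section \<open>Hahn-Banach in Hilbert spaces\<close>

text \<open>Replaces weak compactness: near-minimal norm points of the \<open>C n\<close> form a Cauchy sequence.\<close>

lemma nested_closed_convex_Inter_nonempty:
  fixes C :: "nat \<Rightarrow> 'a::{real_inner, complete_space} set"
  assumes cl: "\<And>n. closed (C n)" and cv: "\<And>n. convex (C n)" and ne: "\<And>n. C n \<noteq> {}"
    and dec: "decseq C" and bd: "bounded (C 0)"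
  shows "(\<Inter>n. C n) \<noteq> {}"
proof -
  define d where "d n = (INF x\<in>C n. (norm x)\<^sup>2)" for n
  obtain B where B: "\<And>x. x \<in> C 0 \<Longrightarrow> norm x \<le> B"
    using bd by (auto simp: bounded_iff)
  have sub: "C n \<subseteq> C m" if "m \<le> n" for m n
    using dec that by (simp add: decseq_def)
  have bb: "bdd_below ((\<lambda>x. (norm x)\<^sup>2) ` A)" for A :: "'a set"
    by (rule bdd_belowI2[of _ 0]) simp
  have d_le: "d n \<le> (norm x)\<^sup>2" if "x \<in> C n" for n x
    unfolding d_def using that by (intro cINF_lower bb)
  have "incseq d"
    unfolding incseq_def d_def
    by (intro allI impI cINF_superset_mono ne bb sub) auto
  moreover have "d n \<le> B\<^sup>2" for n
  proof -
    obtain x where x: "x \<in> C n" using ne[of n] by blast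
    then have "norm x \<le> B" using B sub[of 0 n] by blast
    then have "(norm x)\<^sup>2 \<le> B\<^sup>2" by (simp add: power_mono)
    with d_le[OF x] show ?thesis by linarith
  qed
  ultimately obtain \<delta> where \<delta>: "d \<longlonglongrightarrow> \<delta>" and d_lim: "\<And>n. d n \<le> \<delta>"
    using incseq_convergent[of d "B\<^sup>2"] by blast
  have "\<exists>x\<in>C n. (norm x)\<^sup>2 < d n + inverse (real (Suc n))" for n
    using cINF_less_iff[OF ne[of n] bb, of "d n + inverse (real (Suc n))"]
    unfolding d_def by simp
  then obtain x where xC: "\<And>n. x n \<in> C n"
    and x: "\<And>n. (norm (x n))\<^sup>2 < d n + inverse (real (Suc n))"
    by metis
  \<comment> \<open>Parallelogram-law bound on \<open>(norm (x m - x n))\<^sup>2\<close> for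
    \<open>n \<le> m\<close>: the midpoint lies in \<open>C n\<close>, so its squared norm is at
    least \<open>d n\<close>.\<close>
  define e where "e n = 2 * (\<delta> - d n) + 4 * inverse (real (Suc n))" for n
  have dist_le: "(norm (x m - x n))\<^sup>2 \<le> e n" if mn: "n \<le> m" for m n
  proof -
    have "(1/2) *\<^sub>R x m + (1/2) *\<^sub>R x n \<in> C n"
      using xC[of m] xC[of n] sub[OF mn] by (intro convexD[OF cv]) auto
    from d_le[OF this] have "4 * d n \<le> (norm (x m + x n))\<^sup>2"
      by (simp add: scaleR_add_right[symmetric] power_divide)
    moreover have "(norm (x m - x n))\<^sup>2 + (norm (x m + x n))\<^sup>2 = 2 * (norm (x m))\<^sup>2 + 2 * (norm (x n))\<^sup>2"
      by (simp add: power2_norm_eq_inner algebra_simps)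
    moreover have "inverse (real (Suc m)) \<le> inverse (real (Suc n))"
      using mn by (intro le_imp_inverse_le) auto
    ultimately show ?thesis
      using x[of m] x[of n] d_lim[of m] unfolding e_def by argo
  qed
  have "(\<lambda>n. inverse (real (Suc n))) \<longlonglongrightarrow> 0"
    by (rule LIMSEQ_inverse_real_of_nat)
  then have "e \<longlonglongrightarrow> 2 * (\<delta> - \<delta>) + 4 * 0"
    unfolding e_def by (intro tendsto_add tendsto_mult_left tendsto_diff tendsto_const \<delta>)
  then have e0: "e \<longlonglongrightarrow> 0" by simp
  have "Cauchy x"
  proof (rule CauchyI')
    fix \<epsilon> :: real assume "0 < \<epsilon>"
    then have "0 < \<epsilon>\<^sup>2" by simp
    then obtain N where N: "\<And>n. n \<ge> N \<Longrightarrow> e n < \<epsilon>\<^sup>2"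
      using order_tendstoD(2)[OF e0] unfolding eventually_sequentially by blast
    have "norm (x m - x n) < \<epsilon>" if "m \<ge> N" "n > m" for m n
    proof -
      have "(norm (x n - x m))\<^sup>2 < \<epsilon>\<^sup>2"
        using dist_le[of m n] N[of m] that by simp
      then show ?thesis
        using \<open>0 < \<epsilon>\<close> by (metis less_imp_le norm_minus_commute power_less_imp_less_base)
    qed
    then show "\<exists>M. \<forall>m\<ge>M. \<forall>n>m. dist (x m) (x n) < \<epsilon>"
      unfolding dist_norm by blast
  qed
  then obtain p where p: "x \<longlonglongrightarrow> p"
    using Cauchy_convergent convergent_def by blast
  have "p \<in> C n" for n
  proof (rule Lim_in_closed_set[OF cl _ _ p])
    show "\<forall>\<^sub>F m in sequentially. x m \<in> C n"
      using sub xC by (auto simp: eventually_sequentially intro!: exI[of _ n])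
  qed auto
  then show ?thesis by blast
qed

text \<open>Intersecting \<open>S\<close> with balls around \<open>x\<close> whose radii decrease to
  the distance gives nested sets, and a common point is nearest to \<open>x\<close>. The inequality
  is the obtuse-angle characterisation of nearest points.\<close>

lemma closest_point_hilbert:
  fixes S :: "'a::{real_inner, complete_space} set"
  assumes "closed S" "convex S" "S \<noteq> {}"
  obtains p where "p \<in> S" "\<And>s. s \<in> S \<Longrightarrow> (x - p) \<bullet> (s - p) \<le> 0"
proof -
  define C where "C n = S \<inter> cball x (infdist x S + inverse (real (Suc n)))" for n
  have "(\<Inter>n. C n) \<noteq> {}"
  proof (rule nested_closed_convex_Inter_nonempty)
    show "closed (C n)" "convex (C n)" for n
      unfolding C_def using assms by (auto intro: convex_Int)
    show "C n \<noteq> {}" for n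
    proof -
      have "(INF a\<in>S. dist x a) < infdist x S + inverse (real (Suc n))"
        using assms(3) by (simp add: infdist_notempty)
      then obtain s where "s \<in> S" "dist x s < infdist x S + inverse (real (Suc n))"
        using cINF_less_iff[OF assms(3), of "dist x"] by (auto intro: bdd_belowI2[of _ 0])
      then have "s \<in> C n" unfolding C_def by simp
      then show ?thesis by blast
    qed
    show "decseq C"
      unfolding C_def decseq_def
      by (intro allI impI Int_mono subset_refl subset_cball add_left_mono le_imp_inverse_le) auto
    show "bounded (C 0)"
      unfolding C_def by (simp add: bounded_Int)
  qed
  then obtain p where p: "\<And>n. p \<in> C n" by blast
  have "dist x p \<le> infdist x S"
  proof (rule LIMSEQ_le_const)
    show "(\<lambda>n. infdist x S + inverse (real (Suc n))) \<longlonglongrightarrow> infdist x S"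
      by (rule LIMSEQ_inverse_real_of_nat_add)
    show "\<exists>N. \<forall>n\<ge>N. dist x p \<le> infdist x S + inverse (real (Suc n))"
      using p unfolding C_def by simp
  qed
  then have "\<forall>s\<in>S. dist x p \<le> dist x s"
    using infdist_le order_trans by blast
  moreover have "p \<in> S" using p unfolding C_def by blast
  ultimately show thesis
    using any_closest_point_dot[OF assms(2,1)] that by blast
qed

text \<open>
  Normalising by \<open>z \<bullet> c0 = 1\<close> bounds the functionals which separate up to \<open>1 / (n + 1)\<close>, since \<open>c0\<close> is
  an interior point; an exact one is obtained by intersecting over \<open>n\<close>.
\<close>

lemma separating_functional_hilbert:
  fixes C :: "'a::{real_inner, complete_space} set"
  assumes cv: "convex C" and c0: "c0 \<in> interior C" and 0: "0 \<notin> interior C"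
  obtains z where "z \<bullet> c0 = 1" "\<And>c. c \<in> C \<Longrightarrow> 0 \<le> z \<bullet> c"
proof -
  obtain r where r: "0 < r" "ball c0 r \<subseteq> C" using c0 by (auto simp: mem_interior)
  then have c0C: "c0 \<in> C" by auto
  define Z where "Z n = {z. z \<bullet> c0 = 1 \<and> (\<forall>c\<in>C. - inverse (real (Suc n)) \<le> z \<bullet> c)}" for n
  have "(\<Inter>n. Z n) \<noteq> {}"
  proof (rule nested_closed_convex_Inter_nonempty)
    show "closed (Z n)" for n
      unfolding Z_def Ball_def
      by (intro closed_Collect_conj closed_Collect_all closed_Collect_imp closed_Collect_eq
          closed_Collect_le continuous_intros) auto
    show "convex (Z n)" for n
    proof (rule convexI)
      fix x y and u v :: real
      assume h: "x \<in> Z n" "y \<in> Z n" "0 \<le> u" "0 \<le> v" "u + v = 1"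
      have "- inverse (real (Suc n)) \<le> u * (x \<bullet> c) + v * (y \<bullet> c)" if "c \<in> C" for c
      proof -
        have "- inverse (real (Suc n)) \<le> x \<bullet> c" "- inverse (real (Suc n)) \<le> y \<bullet> c"
          using h that unfolding Z_def by auto
        then have "u * (- inverse (real (Suc n))) + v * (- inverse (real (Suc n)))
            \<le> u * (x \<bullet> c) + v * (y \<bullet> c)"
          using h by (intro add_mono mult_left_mono) auto
        moreover have "u * (- inverse (real (Suc n))) + v * (- inverse (real (Suc n)))
            = - inverse (real (Suc n))"
          unfolding distrib_right[symmetric] h(5) by simp
        ultimately show ?thesis by linarith
      qed
      then show "u *\<^sub>R x + v *\<^sub>R y \<in> Z n"
        using h unfolding Z_def by (simp add: inner_add_left)
    qed
    show "Z n \<noteq> {}" for n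
    proof -
      define k where "k = real (Suc n)"
      have k: "0 < k" unfolding k_def by simp
      \<comment> \<open>A point slightly beyond 0 as seen from \<open>c0\<close>. It stays off the
        closure of \<open>C\<close>, since otherwise 0 would be interior to
        \<open>C\<close>.\<close>
      define xn where "xn = - (inverse k *\<^sub>R c0)"
      have "xn \<notin> closure C"
      proof
        assume "xn \<in> closure C"
        then obtain c where c: "c \<in> C" "dist c xn < r / k"
          using r k by (meson closure_approachable divide_pos_pos)
        \<comment> \<open>Room left in the ball around \<open>c0\<close>: for small \<open>h\<close>
          the point \<open>y = (k + 1) *\<^sub>R h - k *\<^sub>R c\<close> stays within
          \<open>r\<close> of \<open>c0\<close>, so \<open>h\<close> is a convex combination of two
          points of \<open>C\<close>.\<close>
        define \<rho> where "\<rho> = r - norm (k *\<^sub>R c + c0)"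
        have "k *\<^sub>R c + c0 = k *\<^sub>R (c - xn)"
          using k by (simp add: xn_def algebra_simps)
        then have "norm (k *\<^sub>R c + c0) = k * dist c xn"
          using k by (simp add: dist_norm)
        then have "0 < \<rho>"
          using c(2) k by (simp add: \<rho>_def field_simps)
        have "ball 0 (\<rho> / (k + 1)) \<subseteq> C"
        proof
          fix h :: 'a assume "h \<in> ball 0 (\<rho> / (k + 1))"
          then have nh: "(k + 1) * norm h < \<rho>"
            using k by (simp add: field_simps)
          define y where "y = (k + 1) *\<^sub>R h - k *\<^sub>R c"
          have "norm (y - c0) \<le> norm ((k + 1) *\<^sub>R h) + norm (k *\<^sub>R c + c0)"
            using norm_triangle_ineq4[of "(k + 1) *\<^sub>R h" "k *\<^sub>R c + c0"]
            by (simp add: y_def algebra_simps)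
          also have "\<dots> < r"
            using nh k by (simp add: \<rho>_def)
          finally have "y \<in> C"
            using r(2) by (auto simp: dist_norm norm_minus_commute)
          then have "(k / (k + 1)) *\<^sub>R c + (1 / (k + 1)) *\<^sub>R y \<in> C"
            using c(1) k by (intro convexD[OF cv]) (auto simp: field_simps)
          moreover have "(k / (k + 1)) *\<^sub>R c + (1 / (k + 1)) *\<^sub>R y = h"
            using k by (simp add: y_def scaleR_diff_right)
          ultimately show "h \<in> C" by simp
        qed
        then have "0 \<in> interior C"
          using \<open>0 < \<rho>\<close> k by (auto simp: mem_interior intro!: exI[of _ "\<rho> / (k + 1)"])
        with 0 show False ..
      qed
      moreover obtain p where p: "p \<in> closure C"
          "\<And>s. s \<in> closure C \<Longrightarrow> (xn - p) \<bullet> (s - p) \<le> 0"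
        using closest_point_hilbert[of "closure C" xn] cv c0C closure_subset
        by (metis closed_closure convex_closure emptyE subsetD)
      ultimately have "p - xn \<noteq> 0" by auto
      \<comment> \<open>The nearest-point inequality makes \<open>d \<bullet> (c - xn)\<close> at
        least \<open>d \<bullet> d\<close> for \<open>c\<close> in \<open>C\<close>. At
        \<open>c = c0\<close> this forces \<open>0 < d \<bullet> c0\<close>, and dividing
        \<open>d\<close> by that number gives an element of \<open>Z n\<close>.\<close>
      define d where "d = p - xn"
      have dd: "0 < d \<bullet> d" using \<open>p - xn \<noteq> 0\<close> by (simp add: d_def)
      have pos: "0 < d \<bullet> c + inverse k * (d \<bullet> c0)" if "c \<in> C" for c
      proof -
        have "(xn - p) \<bullet> (c - p) \<le> 0" using p(2) that closure_subset by blast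
        then have "d \<bullet> d \<le> d \<bullet> (c - xn)"
          by (simp add: d_def algebra_simps)
        also have "\<dots> = d \<bullet> c + inverse k * (d \<bullet> c0)"
          by (simp add: xn_def inner_add_right)
        finally show ?thesis using dd by linarith
      qed
      have "0 < (1 + inverse k) * (d \<bullet> c0)"
        using pos[OF c0C] by (simp add: algebra_simps)
      moreover have "0 < 1 + inverse k" using k by (simp add: add_pos_pos)
      ultimately have dc: "0 < d \<bullet> c0"
        by (simp add: zero_less_mult_iff)
      have "inverse (d \<bullet> c0) *\<^sub>R d \<in> Z n"
        unfolding Z_def mem_Collect_eq k_def[symmetric]
      proof (intro conjI ballI)
        show "inverse (d \<bullet> c0) *\<^sub>R d \<bullet> c0 = 1" using dc by simp
        fix c assume "c \<in> C"
        show "- inverse k \<le> inverse (d \<bullet> c0) *\<^sub>R d \<bullet> c"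
          using pos[OF \<open>c \<in> C\<close>] dc k by (simp add: field_simps)
      qed
      then show ?thesis by blast
    qed
    show "decseq Z"
    proof -
      have "inverse (real (Suc n)) \<le> inverse (real (Suc m))" if "m \<le> n" for m n
        using that by (intro le_imp_inverse_le) auto
      then show ?thesis
        unfolding decseq_def Z_def by (fastforce intro: order_trans[rotated])
    qed
    show "bounded (Z 0)"
    proof (rule boundedI)
      fix z assume z: "z \<in> Z 0"
      show "norm z \<le> 4 / r"
      proof (cases "z = 0")
        case False
        \<comment> \<open>Half a radius away from \<open>c0\<close> against \<open>z\<close>: still
          in \<open>C\<close>, so the lower bound on \<open>z \<bullet> c\<close> turns into an
          upper bound on \<open>norm z\<close>.\<close>
        define c where "c = c0 - (r / 2 / norm z) *\<^sub>R z"
        have "dist c0 c = r / 2" using r False by (simp add: c_def dist_norm)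
        then have "c \<in> C" using r by auto
        then have "- 1 \<le> z \<bullet> c" and "z \<bullet> c0 = 1" using z unfolding Z_def by auto
        moreover have "z \<bullet> c = z \<bullet> c0 - r / 2 * norm z"
          using False by (simp add: c_def inner_diff_right power2_norm_eq_inner[symmetric] power2_eq_square)
        ultimately have "r / 2 * norm z \<le> 2" by linarith
        then show ?thesis using r by (simp add: field_simps)
      qed (use r in simp)
    qed
  qed
  then obtain z where z: "\<And>n. z \<in> Z n" by blast
  show thesis
  proof
    show "z \<bullet> c0 = 1" using z unfolding Z_def by blast
    fix c assume "c \<in> C"
    show "0 \<le> z \<bullet> c"
    proof (rule LIMSEQ_le_const2)
      show "(\<lambda>n. - inverse (real (Suc n))) \<longlonglongrightarrow> 0"
        using LIMSEQ_inverse_real_of_nat tendsto_minus by fastforce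
      show "\<exists>N. \<forall>n\<ge>N. - inverse (real (Suc n)) \<le> z \<bullet> c"
        using z \<open>c \<in> C\<close> unfolding Z_def by blast
    qed
  qed
qed

text \<open>
  A form of Hahn-Banach with \<open>E\<close> as the epigraph of the dominating function and \<open>\<alpha>\<close> as a functional
  on \<open>T ` K\<close>, which \<open>le\<close> makes well-defined.
\<close>

lemma sandwich_functional_hilbert:
  fixes T :: "'k::real_vector \<Rightarrow> 'a::{real_inner, complete_space}" and \<alpha> :: "'k \<Rightarrow> real"
  assumes T: "linear_operator_on K T" and \<alpha>: "linear_operator_on K \<alpha>"
    and E: "convex E" "(0, b) \<in> interior E" "0 < b"
    and le: "\<And>v s. v \<in> K \<Longrightarrow> (T v, s) \<in> E \<Longrightarrow> \<alpha> v \<le> s"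
  obtains q where "\<And>v. v \<in> K \<Longrightarrow> q \<bullet> T v = \<alpha> v" "\<And>x s. (x, s) \<in> E \<Longrightarrow> q \<bullet> x \<le> s"
proof -
  have sK: "subspace K" and TA: "\<And>x y. x \<in> K \<Longrightarrow> y \<in> K \<Longrightarrow> T (x + y) = T x + T y"
    and TS: "\<And>a x. x \<in> K \<Longrightarrow> T (a *\<^sub>R x) = a *\<^sub>R T x"
    and AA: "\<And>x y. x \<in> K \<Longrightarrow> y \<in> K \<Longrightarrow> \<alpha> (x + y) = \<alpha> x + \<alpha> y"
    and AS: "\<And>a x. x \<in> K \<Longrightarrow> \<alpha> (a *\<^sub>R x) = a *\<^sub>R \<alpha> x"
    using T \<alpha> unfolding linear_operator_on_def by auto
  have T0: "T 0 = 0" and A0: "\<alpha> 0 = 0"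
    using TS[of 0 0] AS[of 0 0] subspace_0[OF sK] by auto
  \<comment> \<open>Differences between points of \<open>E\<close> and points
    \<open>(T v, \<alpha> v)\<close>: a functional that is nonnegative on \<open>C\<close> separates
    the two sets.\<close>
  define C where "C = (\<lambda>(v, x, s). (x - T v, s - \<alpha> v)) ` (K \<times> E)"
  have CI: "(x - T v, s - \<alpha> v) \<in> C" if "v \<in> K" "(x, s) \<in> E" for v x s
    unfolding C_def by (rule image_eqI[of _ _ "(v, x, s)"]) (use that in auto)
  have "convex C"
  proof (rule convexI)
    fix c c' and t t' :: real
    assume "c \<in> C" "c' \<in> C" and t: "0 \<le> t" "0 \<le> t'" "t + t' = 1"
    then obtain v x s v' x' s' where c: "c = (x - T v, s - \<alpha> v)" "v \<in> K" "(x, s) \<in> E"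
      and c': "c' = (x' - T v', s' - \<alpha> v')" "v' \<in> K" "(x', s') \<in> E"
      unfolding C_def by auto
    have v: "t *\<^sub>R v \<in> K" "t' *\<^sub>R v' \<in> K" "t *\<^sub>R v + t' *\<^sub>R v' \<in> K"
      using c c' sK by (auto simp: subspace_add subspace_scale)
    have "t *\<^sub>R (x, s) + t' *\<^sub>R (x', s') \<in> E"
      using c c' t by (intro convexD[OF E(1)]) auto
    then have "(t *\<^sub>R x + t' *\<^sub>R x', t * s + t' * s') \<in> E" by simp
    from CI[OF v(3) this] show "t *\<^sub>R c + t' *\<^sub>R c' \<in> C"
      using c c' v by (simp add: TA TS AA AS algebra_simps)
  qed
  moreover have "E \<subseteq> C"
    using CI[OF subspace_0[OF sK]] by (auto simp: T0 A0)
  then have "(0, b) \<in> interior C" using E(2) interior_mono by blast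
  \<comment> \<open>Otherwise \<open>E\<close> would contain a point \<open>(T v, s)\<close> with
    \<open>s < \<alpha> v\<close>, against \<open>le\<close>.\<close>
  moreover have "0 \<notin> interior C"
  proof
    assume "0 \<in> interior C"
    then obtain e where e: "0 < e" "ball 0 e \<subseteq> C" by (auto simp: mem_interior)
    have "(0, - (e / 2)) \<in> C" using e by (auto simp: dist_norm norm_Pair)
    then obtain v x s where "v \<in> K" "(x, s) \<in> E" "x = T v" "s - \<alpha> v = - (e / 2)"
      unfolding C_def by auto
    then show False using le[of v s] e by auto
  qed
  ultimately obtain z where z: "z \<bullet> (0, b) = 1" "\<And>c. c \<in> C \<Longrightarrow> 0 \<le> z \<bullet> c"
    using separating_functional_hilbert by metis
  obtain \<zeta> \<tau> where z_eq: "z = (\<zeta>, \<tau>)" by fastforce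
  \<comment> \<open>The normalisation at \<open>(0, b)\<close> makes the last component of
    \<open>z\<close> positive, so the separating hyperplane is not vertical and is the graph of a
    functional \<open>q\<close>.\<close>
  have \<tau>b: "\<tau> * b = 1" using z by (simp add: z_eq)
  then have \<tau>: "0 < \<tau>" using E(3) by (metis less_numeral_extra(1) zero_less_mult_pos2)
  define q where "q = - (inverse \<tau> *\<^sub>R \<zeta>)"
  have \<zeta>: "\<zeta> = - (\<tau> *\<^sub>R q)" using \<tau> by (simp add: q_def)
  have main: "0 \<le> s - q \<bullet> x - (\<alpha> v - q \<bullet> T v)" if "v \<in> K" "(x, s) \<in> E" for v x s
  proof -
    have "0 \<le> \<zeta> \<bullet> (x - T v) + \<tau> * (s - \<alpha> v)"
      using z(2)[OF CI[OF that]] by (simp add: z_eq)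
    also have "\<dots> = \<tau> * (s - q \<bullet> x - (\<alpha> v - q \<bullet> T v))"
      by (simp add: \<zeta> algebra_simps)
    finally show ?thesis using \<tau> by (simp add: zero_le_mult_iff)
  qed
  show thesis
  proof
    fix x s assume "(x, s) \<in> E"
    from main[OF subspace_0[OF sK] this] show "q \<bullet> x \<le> s" by (simp add: T0 A0)
  next
    fix v assume v: "v \<in> K"
    \<comment> \<open>Along the line through \<open>v\<close>, \<open>main\<close> bounds every
      multiple of the defect \<open>a\<close> by \<open>b\<close>, which forces
      \<open>a = 0\<close>.\<close>
    define a where "a = \<alpha> v - q \<bullet> T v"
    have "t * a \<le> b" for t :: real
    proof -
      have "t *\<^sub>R v \<in> K" using v sK by (simp add: subspace_scale)
      moreover have "(0, b) \<in> E" using E(2) interior_subset by blast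
      ultimately have "0 \<le> b - q \<bullet> 0 - (\<alpha> (t *\<^sub>R v) - q \<bullet> T (t *\<^sub>R v))"
        by (rule main)
      then show ?thesis using v by (simp add: a_def TS AS algebra_simps)
    qed
    from this[of "(b + 1) / a"] have "a = 0" by (cases "a = 0") auto
    then show "q \<bullet> T v = \<alpha> v" by (simp add: a_def)
  qed
qed

section \<open>Adjoints and orthogonal projections\<close>

text \<open>\<open>G \<times> {S..}\<close> is the epigraph of the function equal to
  \<open>S\<close> on \<open>G\<close> and infinite elsewhere; by hypothesis
  \<open>w \<bullet> \<phi>\<close> lies below it along \<open>L\<close>. The height
  \<open>S + 1\<close> gives the sandwich its interior point over 0, positive even if
  \<open>S = 0\<close>.\<close>

lemma adjoint_equation_solution:
  fixes L :: "'h::real_inner \<Rightarrow> 'f::{real_inner, complete_space}"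
  assumes L: "linear_operator_on D L" and G: "convex G" "0 \<in> interior G"
    and le: "\<And>\<phi>. \<phi> \<in> D \<Longrightarrow> L \<phi> \<in> G \<Longrightarrow> w \<bullet> \<phi> \<le> S"
  obtains z where "\<And>\<phi>. \<phi> \<in> D \<Longrightarrow> L \<phi> \<bullet> z = \<phi> \<bullet> w" "\<And>g. g \<in> G \<Longrightarrow> z \<bullet> g \<le> S"
proof -
  have "0 \<in> D" using L by (simp add: linear_operator_on_def subspace_0)
  moreover from this have "L (0 *\<^sub>R 0) = 0 *\<^sub>R L 0"
    using L unfolding linear_operator_on_def by blast
  moreover have "0 \<in> G" using G(2) interior_subset by blast
  ultimately have S: "0 \<le> S" using le[of 0] by simp
  have \<alpha>: "linear_operator_on D (\<lambda>\<phi>. w \<bullet> \<phi>)"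
    using L unfolding linear_operator_on_def by (simp add: inner_add_right)
  have E: "convex (G \<times> {S..})" "(0, S + 1) \<in> interior (G \<times> {S..})"
    using G by (auto simp: interior_Times intro: convex_Times)
  show thesis
  proof (rule sandwich_functional_hilbert[OF L \<alpha> E])
    show "0 < S + 1" using S by simp
    show "w \<bullet> v \<le> s" if "v \<in> D" "(L v, s) \<in> G \<times> {S..}" for v s
      using le[of v] that by auto
  next
    fix q assume "\<And>v. v \<in> D \<Longrightarrow> q \<bullet> L v = w \<bullet> v"
      and "\<And>x s. (x, s) \<in> G \<times> {S..} \<Longrightarrow> q \<bullet> x \<le> s"
    then show thesis
      by (intro that[of q]) (auto simp: inner_commute)
  qed
qed

text \<open>\<open>adjoint\<close> is defined by choice, so some function with this property has to
  be found first. For fixed \<open>y\<close> this is the Riesz representation of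
  \<open>H x \<bullet> y\<close> as a functional of \<open>x\<close>, obtained from the sandwich
  with \<open>T\<close> the identity and the bound \<open>K * norm y\<close> on the unit
  ball.\<close>

lemma inner_adjoint_hilbert:
  fixes H :: "'h::{real_inner, complete_space} \<Rightarrow> 'y::real_inner"
  assumes "bounded_linear H"
  shows "x \<bullet> adjoint H y = H x \<bullet> y"
proof -
  interpret bounded_linear H by fact
  obtain K where K: "0 \<le> K" "\<And>x. norm (H x) \<le> norm x * K"
    using nonneg_bounded by blast
  have "\<exists>w. \<forall>x. H x \<bullet> y = x \<bullet> w" for y
  proof -
    have id: "linear_operator_on UNIV (\<lambda>x::'h. x)"
      unfolding linear_operator_on_def by simp
    have \<alpha>: "linear_operator_on UNIV (\<lambda>x. H x \<bullet> y)"
      unfolding linear_operator_on_def by (simp add: add scaleR inner_add_left)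
    have E: "convex (ball (0::'h) 1 \<times> {K * norm y..})"
      "(0, K * norm y + 1) \<in> interior (ball (0::'h) 1 \<times> {K * norm y..})"
      by (auto simp: interior_Times intro: convex_Times)
    have "H v \<bullet> y \<le> s" if "(v, s) \<in> ball 0 1 \<times> {K * norm y..}" for v s
    proof -
      have "H v \<bullet> y \<le> norm (H v) * norm y" by (rule norm_cauchy_schwarz)
      also have "\<dots> \<le> (norm v * K) * norm y" by (intro mult_right_mono K) auto
      also have "\<dots> \<le> (1 * K) * norm y" using that K by (intro mult_right_mono) auto
      also have "\<dots> \<le> s" using that by auto
      finally show ?thesis .
    qed
    then obtain q where "\<And>v. q \<bullet> v = H v \<bullet> y"
      using sandwich_functional_hilbert[OF id \<alpha> E] K(1)
      by (metis UNIV_I add_nonneg_pos mult_nonneg_nonneg norm_ge_zero zero_less_one)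
    then show ?thesis by (metis inner_commute)
  qed
  then obtain f where "\<forall>x y. H x \<bullet> y = x \<bullet> f y" by metis
  then show ?thesis by (metis adjoint_unique)
qed

lemma linear_adjoint_hilbert:
  fixes H :: "'h::{real_inner, complete_space} \<Rightarrow> 'y::real_inner"
  assumes "bounded_linear H"
  shows "linear (adjoint H)"
proof (rule linearI)
  show "adjoint H (x + y) = adjoint H x + adjoint H y" for x y
    by (rule vector_eq_ldot[THEN iffD1])
      (simp add: inner_adjoint_hilbert[OF assms] inner_add_right)
  show "adjoint H (c *\<^sub>R x) = c *\<^sub>R adjoint H x" for c x
    by (rule vector_eq_ldot[THEN iffD1]) (simp add: inner_adjoint_hilbert[OF assms])
qed

section \<open>Orthogonal projections onto closed subspaces\<close>

lemma orth_proj_eqI: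
  assumes "subspace S" "p \<in> S" "\<And>s. s \<in> S \<Longrightarrow> (x - p) \<bullet> s = 0"
  shows "orth_proj S x = p"
  unfolding orth_proj_def
proof (rule the_equality)
  show "p \<in> S \<and> (\<forall>s\<in>S. orthogonal (x - p) s)"
    using assms by (auto simp: orthogonal_def)
  fix p' assume p': "p' \<in> S \<and> (\<forall>s\<in>S. orthogonal (x - p') s)"
  then have "p - p' \<in> S" using assms by (simp add: subspace_diff)
  then have "(x - p') \<bullet> (p - p') = 0" "(x - p) \<bullet> (p - p') = 0"
    using assms(3) p' by (auto simp: orthogonal_def)
  then have "(p - p') \<bullet> (p - p') = 0" by (simp add: algebra_simps)
  then show "p' = p" by simp
qed

text \<open>Moving the nearest point \<open>p\<close> by \<open>s\<close> or by \<open>- s\<close>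
  stays in the subspace, so the nearest-point inequality holds with both signs and becomes
  orthogonality.\<close>

lemma orth_proj_hilbert:
  fixes S :: "'a::{real_inner, complete_space} set"
  assumes "subspace S" "closed S"
  shows "orth_proj S x \<in> S" "s \<in> S \<Longrightarrow> (x - orth_proj S x) \<bullet> s = 0"
proof -
  obtain p where p: "p \<in> S" "\<And>s. s \<in> S \<Longrightarrow> (x - p) \<bullet> (s - p) \<le> 0"
    using closest_point_hilbert[OF assms(2) subspace_imp_convex[OF assms(1)]]
      subspace_0[OF assms(1)] by blast
  have orth: "(x - p) \<bullet> s = 0" if "s \<in> S" for s
  proof -
    have "p + s \<in> S" "p - s \<in> S"
      using p(1) that assms(1) by (auto simp: subspace_add subspace_diff)
    from p(2)[OF this(1)] p(2)[OF this(2)] show ?thesis by (simp add: inner_diff_right)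
  qed
  have "orth_proj S x = p" by (rule orth_proj_eqI[OF assms(1) p(1) orth])
  then show "orth_proj S x \<in> S" "s \<in> S \<Longrightarrow> (x - orth_proj S x) \<bullet> s = 0"
    using p(1) orth by auto
qed

lemma orth_proj_linear_combination:
  fixes S :: "'a::{real_inner, complete_space} set"
  assumes S: "subspace S" "closed S"
  shows "orth_proj S (a *\<^sub>R x + b *\<^sub>R y) = a *\<^sub>R orth_proj S x + b *\<^sub>R orth_proj S y"
proof (rule orth_proj_eqI[OF S(1)])
  show "a *\<^sub>R orth_proj S x + b *\<^sub>R orth_proj S y \<in> S"
    using orth_proj_hilbert(1)[OF S] S(1) by (intro subspace_add subspace_scale)
  fix s assume s: "s \<in> S"
  have "(a *\<^sub>R x + b *\<^sub>R y - (a *\<^sub>R orth_proj S x + b *\<^sub>R orth_proj S y)) \<bullet> s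
      = a * ((x - orth_proj S x) \<bullet> s) + b * ((y - orth_proj S y) \<bullet> s)"
    by (simp add: algebra_simps)
  then show "(a *\<^sub>R x + b *\<^sub>R y - (a *\<^sub>R orth_proj S x + b *\<^sub>R orth_proj S y)) \<bullet> s = 0"
    using orth_proj_hilbert(2)[OF S s] by simp
qed

lemma norm_orth_proj_le:
  fixes S :: "'a::{real_inner, complete_space} set"
  assumes S: "subspace S" "closed S"
  shows "norm (orth_proj S x) \<le> norm x"
proof -
  let ?p = "orth_proj S x"
  have "(x - ?p) \<bullet> ?p = 0" by (intro orth_proj_hilbert[OF S])
  then have "x \<bullet> x = ?p \<bullet> ?p + (x - ?p) \<bullet> (x - ?p)"
    by (simp add: algebra_simps inner_commute)
  then show ?thesis by (simp add: norm_le)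
qed

text \<open>The residual \<open>y - ?p\<close> is orthogonal to \<open>S\<close>, hence to
  \<open>?p\<close>, and by hypothesis to \<open>y\<close>; so it is orthogonal to itself and
  vanishes.\<close>

lemma double_orth_complement:
  fixes S :: "'a::{real_inner, complete_space} set"
  assumes S: "subspace S" "closed S" and y: "\<And>v. (\<And>s. s \<in> S \<Longrightarrow> v \<bullet> s = 0) \<Longrightarrow> y \<bullet> v = 0"
  shows "y \<in> S"
proof -
  let ?p = "orth_proj S y"
  have "y \<bullet> (y - ?p) = 0" by (intro y orth_proj_hilbert[OF S])
  moreover have "(y - ?p) \<bullet> ?p = 0" by (intro orth_proj_hilbert[OF S])
  ultimately have "(y - ?p) \<bullet> (y - ?p) = 0" by (simp add: algebra_simps inner_commute)
  then show ?thesis using orth_proj_hilbert(1)[OF S, of y] by simp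
qed

section \<open>Closed densely defined operators\<close>

locale closed_dense_operator =
  fixes D :: "'h::{real_inner, complete_space} set"
    and L :: "'h \<Rightarrow> 'f::{real_inner, complete_space}"
  assumes closed_op: "closed_operator_on D L" and dense: "closure D = UNIV"
begin

lemma linear_op: "linear_operator_on D L"
  using closed_op by (simp add: closed_operator_on_def)

lemma subspace_D: "subspace D"
  using linear_op by (simp add: linear_operator_on_def)

lemma L_add: "x \<in> D \<Longrightarrow> y \<in> D \<Longrightarrow> L (x + y) = L x + L y"
  and L_scaleR: "x \<in> D \<Longrightarrow> L (a *\<^sub>R x) = a *\<^sub>R L x"
  using linear_op by (auto simp: linear_operator_on_def)

lemma L_minus: "x \<in> D \<Longrightarrow> L (- x) = - L x"
  using L_scaleR[of x "-1"] by simp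

lemma L_diff: "x \<in> D \<Longrightarrow> y \<in> D \<Longrightarrow> L (x - y) = L x - L y"
  using L_add[of x "- y"] by (simp add: L_minus subspace_neg[OF subspace_D])

lemma L_0: "L 0 = 0"
  using L_scaleR[OF subspace_0[OF subspace_D], of 0] by simp

lemma closed_graphD:
  assumes "\<And>n. x n \<in> D" "x \<longlonglongrightarrow> p" "(\<lambda>n. L (x n)) \<longlonglongrightarrow> v"
  shows "p \<in> D" "L p = v"
proof -
  have "(p, v) \<in> (\<lambda>x. (x, L x)) ` D"
  proof (rule closed_sequentially)
    show "closed ((\<lambda>x. (x, L x)) ` D)"
      using closed_op by (simp add: closed_operator_on_def)
    show "(\<lambda>n. (x n, L (x n))) \<longlonglongrightarrow> (p, v)"
      using assms by (intro tendsto_Pair)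
  qed (use assms in auto)
  then show "p \<in> D" "L p = v" by auto
qed

section \<open>The adjoint and its range\<close>

lemma adj_unique:
  assumes "\<And>\<phi>. \<phi> \<in> D \<Longrightarrow> \<phi> \<bullet> w = \<phi> \<bullet> w'"
  shows "w = w'"
proof -
  have "closure D \<subseteq> {\<phi>. \<phi> \<bullet> (w - w') = 0}"
    using assms by (intro closure_minimal)
      (auto simp: inner_diff_right intro!: closed_Collect_eq continuous_intros)
  then have "(w - w') \<bullet> (w - w') = 0" unfolding dense by blast
  then show ?thesis by simp
qed

text \<open>Density makes \<open>w\<close> unique, so the definite description in
  \<open>adj_op\<close> can be traded for its defining identity from here on.\<close>

lemma adj_op_iff:
  "z \<in> adj_dom D L \<and> adj_op D L z = w \<longleftrightarrow> (\<forall>\<phi>\<in>D. L \<phi> \<bullet> z = \<phi> \<bullet> w)"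
proof -
  have "adj_op D L z = w'" if "\<forall>\<phi>\<in>D. L \<phi> \<bullet> z = \<phi> \<bullet> w'" for w'
    unfolding adj_op_def
    by (rule the_equality) (use that adj_unique in auto)
  then show ?thesis unfolding adj_dom_def by auto
qed

lemma adj_range_iff: "w \<in> adj_range D L \<longleftrightarrow> (\<exists>z. \<forall>\<phi>\<in>D. L \<phi> \<bullet> z = \<phi> \<bullet> w)"
  unfolding adj_range_def image_iff by (metis adj_op_iff)

lemma subspace_adj_range: "subspace (adj_range D L)"
proof (rule subspaceI)
  show "0 \<in> adj_range D L"
    unfolding adj_range_iff by (rule exI[of _ 0]) simp
  fix x y assume "x \<in> adj_range D L" "y \<in> adj_range D L"
  then obtain z z' where "\<forall>\<phi>\<in>D. L \<phi> \<bullet> z = \<phi> \<bullet> x" "\<forall>\<phi>\<in>D. L \<phi> \<bullet> z' = \<phi> \<bullet> y"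
    unfolding adj_range_iff by blast
  then show "x + y \<in> adj_range D L"
    unfolding adj_range_iff by (intro exI[of _ "z + z'"]) (simp add: inner_add_right)
next
  fix c x assume "x \<in> adj_range D L"
  then obtain z where "\<forall>\<phi>\<in>D. L \<phi> \<bullet> z = \<phi> \<bullet> x" unfolding adj_range_iff by blast
  then show "c *\<^sub>R x \<in> adj_range D L"
    unfolding adj_range_iff by (intro exI[of _ "c *\<^sub>R z"]) simp
qed

lemma adj_range_orth_null_space:
  "w \<in> adj_range D L \<Longrightarrow> n \<in> null_space D L \<Longrightarrow> w \<bullet> n = 0"
  unfolding adj_range_iff null_space_def by (auto simp: inner_commute)

lemma subspace_null_space: "subspace (null_space D L)"
  using subspace_D unfolding null_space_def subspace_def
  by (auto simp: L_0 L_add L_scaleR)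

text \<open>
  Preimages converge weakly only; a point common to the closures of the sets \<open>A m\<close> of approximate
  preimages is a strong limit along which the closed graph applies.
\<close>

lemma closed_image_cball: "closed (L ` (D \<inter> cball 0 r))"
  unfolding closed_sequential_limits
proof (intro allI impI, elim conjE)
  fix X v assume X: "\<forall>n. X n \<in> L ` (D \<inter> cball 0 r)" and Xv: "X \<longlonglongrightarrow> v"
  have XL: "\<exists>\<phi>\<in>D. norm \<phi> \<le> r \<and> L \<phi> = X n" for n
    using X[rule_format, of n] by force
  define A where "A m = {\<phi> \<in> D. norm \<phi> \<le> r \<and> dist v (L \<phi>) \<le> inverse (real (Suc m))}" for m
  have "(\<Inter>m. closure (A m)) \<noteq> {}"
  proof (rule nested_closed_convex_Inter_nonempty)
    show "convex (closure (A m))" for m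
    proof (intro convex_closure convexI)
      fix x y and s t :: real
      assume h: "x \<in> A m" "y \<in> A m" "0 \<le> s" "0 \<le> t" "s + t = 1"
      have "s *\<^sub>R x + t *\<^sub>R y \<in> cball 0 r"
        using h unfolding A_def by (intro convexD[OF convex_cball]) auto
      moreover have "s *\<^sub>R L x + t *\<^sub>R L y \<in> cball v (inverse (real (Suc m)))"
        using h unfolding A_def by (intro convexD[OF convex_cball]) auto
      ultimately show "s *\<^sub>R x + t *\<^sub>R y \<in> A m"
        using h subspace_D unfolding A_def
        by (simp add: L_add L_scaleR subspace_add subspace_scale)
    qed
    show "closure (A m) \<noteq> {}" for m
    proof -
      have "\<forall>\<^sub>F n in sequentially. dist (X n) v < inverse (real (Suc m))"
        using Xv by (rule tendstoD) simp
      then obtain n where "dist (X n) v < inverse (real (Suc m))"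
        using eventually_sequentially by auto
      then show ?thesis
        using XL[of n] unfolding A_def by (fastforce simp: dist_commute)
    qed
    show "decseq (\<lambda>m. closure (A m))"
    proof -
      have "inverse (real (Suc n)) \<le> inverse (real (Suc m))" if "m \<le> n" for m n
        using that by (intro le_imp_inverse_le) auto
      then show ?thesis
        unfolding decseq_def A_def
        by (intro allI impI closure_mono) (fastforce intro: order_trans)
    qed
    show "bounded (closure (A 0))"
      unfolding A_def by (intro bounded_closure boundedI[of _ r]) auto
  qed auto
  then obtain p where p: "\<And>m. p \<in> closure (A m)" by blast
  have "\<exists>x\<in>A m. dist x p < inverse (real (Suc m))" for m
    using p[of m] by (simp add: closure_approachable)
  then obtain x where x: "\<And>m. x m \<in> A m" "\<And>m. dist (x m) p < inverse (real (Suc m))"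
    by metis
  have "x \<longlonglongrightarrow> p"
    by (rule tendsto_dist_iff[THEN iffD2], rule tendsto_sandwich[OF _ _ tendsto_const LIMSEQ_inverse_real_of_nat])
      (auto intro!: always_eventually less_imp_le x(2)[simplified])
  moreover have "(\<lambda>m. L (x m)) \<longlonglongrightarrow> v"
    by (rule tendsto_dist_iff[THEN iffD2], rule tendsto_sandwich[OF _ _ tendsto_const LIMSEQ_inverse_real_of_nat])
      (use x(1) in \<open>auto intro!: always_eventually simp: A_def dist_commute\<close>)
  ultimately have "p \<in> D" "L p = v"
    using closed_graphD[of x p v] x(1) unfolding A_def by auto
  moreover have "norm p \<le> r"
  proof -
    have "closure (A 0) \<subseteq> cball 0 r" by (rule closure_minimal) (auto simp: A_def)
    then show ?thesis using p[of 0] by auto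
  qed
  ultimately show "v \<in> L ` (D \<inter> cball 0 r)" by auto
qed

text \<open>Quantitative open mapping theorem. The closed range is completely metrizable and is the
  union of the closed images of the balls of radius \<open>n\<close>, so by Baire one of these has
  an interior point relative to the range.\<close>

lemma bounded_preimage_of_closed_range:
  assumes "closed (L ` D)"
  obtains K where "0 \<le> K"
    "\<And>\<phi>. \<phi> \<in> D \<Longrightarrow> \<exists>\<psi>\<in>D. L \<psi> = L \<phi> \<and> norm \<psi> \<le> K * norm (L \<phi>)"
proof -
  let ?X = "top_of_set (L ` D)"
  let ?E = "\<lambda>n::nat. L ` (D \<inter> cball 0 (real n))"
  have "\<exists>n. ?X interior_of ?E n \<noteq> {}"
  proof (rule ccontr)
    assume "\<not> ?thesis"
    then have none: "?X interior_of ?E n = {}" for n by blast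
    have "?X interior_of \<Union>(range ?E) = {}"
    proof (rule Baire_category_alt)
      have "completely_metrizable_space ?X"
        using assms completely_metrizable_space_closedin completely_metrizable_space_euclidean
        by (metis closed_closedin)
      then show "completely_metrizable_space ?X \<or> locally_compact_space ?X \<and> regular_space ?X" ..
      show "closedin ?X T \<and> ?X interior_of T = {}" if T: "T \<in> range ?E" for T
      proof -
        have "closed T" using T closed_image_cball by auto
        moreover have "T \<subseteq> L ` D" using T by auto
        ultimately have "closedin ?X T" by (rule closed_subset[rotated])
        then show ?thesis using T none by auto
      qed
    qed auto
    moreover have "\<Union>(range ?E) = topspace ?X"
      using real_arch_simple by fastforce
    ultimately have "L ` D = {}" by (metis interior_of_topspace topspace_euclidean_subtopology)
    then show False using subspace_0[OF subspace_D] by auto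
  qed
  then obtain n v0 where "v0 \<in> ?X interior_of ?E n" by blast
  then obtain U where U: "openin ?X U" "v0 \<in> U" "U \<subseteq> ?E n"
    unfolding interior_of_def by auto
  then obtain r where r: "0 < r" "ball v0 r \<inter> L ` D \<subseteq> ?E n"
    unfolding openin_contains_ball by (meson order_trans)
  obtain x0 where x0: "x0 \<in> D" "norm x0 \<le> n" "v0 = L x0" using U(2,3) by auto
  \<comment> \<open>Subtracting the preimage \<open>x0\<close> of the centre \<open>v0\<close> moves
    the ball to 0 and at most doubles the norm bound.\<close>
  have small: "\<exists>\<psi>\<in>D. L \<psi> = L \<phi> \<and> norm \<psi> \<le> 2 * real n" if "\<phi> \<in> D" "norm (L \<phi>) < r" for \<phi>
  proof -
    have "L (x0 + \<phi>) \<in> ball v0 r"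
      using that x0 by (simp add: L_add dist_norm)
    moreover have "L (x0 + \<phi>) \<in> L ` D"
      using that x0 subspace_D by (simp add: subspace_add)
    ultimately have "L (x0 + \<phi>) \<in> ?E n" using r(2) by blast
    then obtain x1 where "x1 \<in> D" "norm x1 \<le> n" "L x1 = L (x0 + \<phi>)" by auto
    then show ?thesis
      using x0 that subspace_D norm_triangle_ineq4[of x1 x0]
      by (intro bexI[of _ "x1 - x0"]) (auto simp: L_add L_diff subspace_diff)
  qed
  show thesis
  proof (rule that[of "4 * real n / r"])
    fix \<phi> assume \<phi>: "\<phi> \<in> D"
    show "\<exists>\<psi>\<in>D. L \<psi> = L \<phi> \<and> norm \<psi> \<le> 4 * real n / r * norm (L \<phi>)"
    proof (cases "L \<phi> = 0")
      case True
      then show ?thesis using subspace_0[OF subspace_D] L_0 by (intro bexI[of _ 0]) auto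
    next
      case False
      \<comment> \<open>Scales \<open>L \<phi>\<close> to norm \<open>r / 2\<close>, where
        \<open>small\<close> applies.\<close>
      define t where "t = r / (2 * norm (L \<phi>))"
      have t: "0 < t" using r False by (simp add: t_def)
      have "t *\<^sub>R \<phi> \<in> D" "norm (L (t *\<^sub>R \<phi>)) < r"
        using \<phi> r t False subspace_D by (auto simp: L_scaleR subspace_scale t_def)
      then obtain \<psi> where \<psi>: "\<psi> \<in> D" "L \<psi> = L (t *\<^sub>R \<phi>)" "norm \<psi> \<le> 2 * real n"
        using small by blast
      have "norm (inverse t *\<^sub>R \<psi>) \<le> inverse t * (2 * real n)"
        using \<psi>(3) t by (simp add: mult_left_mono)
      also have "\<dots> = 4 * real n / r * norm (L \<phi>)"
        using False r by (simp add: t_def field_simps)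
      finally show ?thesis
        using \<psi> \<phi> t subspace_D
        by (intro bexI[of _ "inverse t *\<^sub>R \<psi>"]) (auto simp: L_scaleR subspace_scale)
    qed
  qed (use r in simp)
qed

text \<open>For \<open>w\<close> orthogonal to the null space, \<open>w \<bullet> \<phi>\<close> is
  unchanged when \<open>\<phi>\<close> is replaced by a preimage \<open>\<psi>\<close> of controlled
  norm, so it is bounded over all \<open>\<phi>\<close> with \<open>L \<phi>\<close> in the unit
  ball. The adjoint equation is then solvable with that ball in the role of
  \<open>G\<close>.\<close>

lemma closed_range_adjoint:
  assumes "closed (L ` D)"
  shows "adj_range D L = {w. \<forall>n \<in> null_space D L. w \<bullet> n = 0}"
proof (intro equalityI subsetI)
  fix w assume "w \<in> {w. \<forall>n \<in> null_space D L. w \<bullet> n = 0}"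
  then have w: "w \<bullet> n = 0" if "n \<in> null_space D L" for n using that by blast
  obtain K where K: "0 \<le> K"
    "\<And>\<phi>. \<phi> \<in> D \<Longrightarrow> \<exists>\<psi>\<in>D. L \<psi> = L \<phi> \<and> norm \<psi> \<le> K * norm (L \<phi>)"
    using bounded_preimage_of_closed_range[OF assms] by blast
  have "w \<bullet> \<phi> \<le> norm w * K" if \<phi>: "\<phi> \<in> D" "L \<phi> \<in> ball 0 1" for \<phi>
  proof -
    obtain \<psi> where \<psi>: "\<psi> \<in> D" "L \<psi> = L \<phi>" "norm \<psi> \<le> K * norm (L \<phi>)"
      using K(2) \<phi>(1) by blast
    have "\<phi> - \<psi> \<in> null_space D L"
      using \<phi> \<psi> subspace_D by (simp add: null_space_def L_diff subspace_diff)
    from w[OF this] have "w \<bullet> \<phi> = w \<bullet> \<psi>" by (simp add: inner_diff_right)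
    also have "\<dots> \<le> norm w * norm \<psi>" by (rule norm_cauchy_schwarz)
    also have "\<dots> \<le> norm w * (K * 1)"
      using \<psi>(3) \<phi>(2) K(1) by (intro mult_left_mono order_trans[OF \<psi>(3)]) auto
    finally show ?thesis by simp
  qed
  then obtain z where "\<And>\<phi>. \<phi> \<in> D \<Longrightarrow> L \<phi> \<bullet> z = \<phi> \<bullet> w"
    using adjoint_equation_solution[OF linear_op convex_ball, of 0 1 w "norm w * K"]
    by (metis centre_in_ball interior_open open_ball zero_less_one)
  then show "w \<in> adj_range D L" unfolding adj_range_iff by blast
qed (simp add: adj_range_orth_null_space)

lemma closed_adj_range:
  assumes "closed (L ` D)"
  shows "closed (adj_range D L)"
  unfolding closed_range_adjoint[OF assms] Ball_def
  by (intro closed_Collect_all closed_Collect_imp closed_Collect_eq continuous_intros) auto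

end

section \<open>Duality and the minimax estimation\<close>

lemma square_convex_combination_le:
  fixes a b r s :: real
  assumes "0 \<le> r" "0 \<le> s" "r + s = 1"
  shows "(r * a + s * b)\<^sup>2 \<le> r * a\<^sup>2 + s * b\<^sup>2"
proof -
  have s: "s = 1 - r" using assms by simp
  have "(r * a + s * b)\<^sup>2 = r * a\<^sup>2 + s * b\<^sup>2 - r * s * (a - b)\<^sup>2"
    unfolding s by (simp add: power2_eq_square algebra_simps)
  then show ?thesis using assms by simp
qed

section \<open>Mean-squared errors under admissible noise\<close>

lemma admissible_noise_mse:
  assumes "admissible_noise \<Omega> \<eta>"
  shows "prob_space.expectation \<Omega> (\<lambda>\<omega>. (a - u \<bullet> \<eta> \<omega>)\<^sup>2) \<le> a\<^sup>2 + u \<bullet> u"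
proof -
  interpret prob_space \<Omega> using assms by (simp add: admissible_noise_def)
  have [measurable]: "\<eta> \<in> borel_measurable \<Omega>"
    and mean: "expectation (\<lambda>\<omega>. u \<bullet> \<eta> \<omega>) = 0"
    and int: "integrable \<Omega> (\<lambda>\<omega>. \<eta> \<omega> \<bullet> \<eta> \<omega>)"
    and le1: "expectation (\<lambda>\<omega>. \<eta> \<omega> \<bullet> \<eta> \<omega>) \<le> 1"
    using assms by (auto simp: admissible_noise_def)
  have "(\<lambda>x. u \<bullet> x) \<in> borel_measurable borel"
    by (intro borel_measurable_continuous_onI continuous_intros)
  then have [measurable]: "(\<lambda>\<omega>. u \<bullet> \<eta> \<omega>) \<in> borel_measurable \<Omega>"
    by (rule measurable_compose[rotated]) measurable
  have CS: "(u \<bullet> \<eta> \<omega>)\<^sup>2 \<le> (u \<bullet> u) * (\<eta> \<omega> \<bullet> \<eta> \<omega>)" for \<omega>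
    by (rule Cauchy_Schwarz_ineq)
  \<comment> \<open>Non-integrable functions have integral 0 by default, so integrability comes
    before expanding and comparing expectations. On a probability space square integrability also
    yields that of the linear term.\<close>
  have int2: "integrable \<Omega> (\<lambda>\<omega>. (u \<bullet> \<eta> \<omega>)\<^sup>2)"
    by (rule Bochner_Integration.integrable_bound[OF integrable_mult_right[OF int, of "u \<bullet> u"]])
      (use CS in \<open>auto simp: abs_mult\<close>)
  have int1: "integrable \<Omega> (\<lambda>\<omega>. u \<bullet> \<eta> \<omega>)"
    by (rule square_integrable_imp_integrable[OF _ int2]) measurable
  have "expectation (\<lambda>\<omega>. (a - u \<bullet> \<eta> \<omega>)\<^sup>2)
      = expectation (\<lambda>\<omega>. (a\<^sup>2 - 2 * a * (u \<bullet> \<eta> \<omega>)) + (u \<bullet> \<eta> \<omega>)\<^sup>2)"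
    by (rule Bochner_Integration.integral_cong) (auto simp: power2_eq_square algebra_simps)
  also have "\<dots> = a\<^sup>2 + expectation (\<lambda>\<omega>. (u \<bullet> \<eta> \<omega>)\<^sup>2)"
    using int1 int2 by (simp add: mean prob_space)
  also have "expectation (\<lambda>\<omega>. (u \<bullet> \<eta> \<omega>)\<^sup>2) \<le> expectation (\<lambda>\<omega>. (u \<bullet> u) * (\<eta> \<omega> \<bullet> \<eta> \<omega>))"
    by (rule integral_mono) (use int int2 CS in auto)
  also have "\<dots> \<le> (u \<bullet> u) * 1"
    using le1 by (simp add: mult_left_le)
  finally show ?thesis by simp
qed

text \<open>Equal weights on \<open>sgn u\<close> and \<open>- sgn u\<close> make
  \<open>u \<bullet> \<eta> \<omega>\<close> equal to plus or minus \<open>norm u\<close>, so the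
  bound of \<open>admissible_noise_mse\<close> is attained for every \<open>a\<close> at once. For
  \<open>u = 0\<close> both points are 0.\<close>

lemma extremal_noise:
  fixes u :: "'y::real_inner"
  obtains \<Omega> :: "'y measure" and \<eta> where "admissible_noise \<Omega> \<eta>"
    "\<And>a. prob_space.expectation \<Omega> (\<lambda>\<omega>. (a - u \<bullet> \<eta> \<omega>)\<^sup>2) = a\<^sup>2 + u \<bullet> u"
proof -
  define p where "p = map_pmf (\<lambda>b. if b then sgn u else - sgn u) (bernoulli_pmf (1/2))"
  have E: "(\<integral>\<omega>. f \<omega> \<partial>measure_pmf p) = (f (sgn u) + f (- sgn u)) / 2" for f :: "'y \<Rightarrow> real"
    unfolding p_def by (simp add: field_simps)
  have "u \<bullet> sgn u = norm u" "sgn u \<bullet> sgn u \<le> 1"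
    by (cases "u = 0"; simp add: sgn_div_norm power2_norm_eq_inner[symmetric] power2_eq_square)+
  moreover have "integrable (measure_pmf p) (\<lambda>\<omega>. \<omega> \<bullet> \<omega>)"
    by (rule integrable_measure_pmf_finite) (simp add: p_def)
  ultimately show thesis
    by (intro that[of "measure_pmf p" "\<lambda>\<omega>. \<omega>"])
      (auto simp: admissible_noise_def E prob_space_measure_pmf power2_eq_square
        algebra_simps power2_norm_eq_inner[symmetric])
qed

locale minimax_problem = closed_dense_operator D L
  for D :: "'h::{real_inner, complete_space} set"
    and L :: "'h \<Rightarrow> 'f::{real_inner, complete_space}" +
  fixes H :: "'h \<Rightarrow> 'y::{real_inner, complete_space}" and G :: "'f set"
  assumes bounded_linear_H: "bounded_linear H"
    and convex_G: "convex G" and bounded_G: "bounded G" and balanced_G: "balanced G"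
    and zero_interior_G: "0 \<in> interior G"
begin

section \<open>Duality between feasible states and solutions of the adjoint equation\<close>

definition feasible :: "'h set" where
  "feasible = {\<phi> \<in> D. L \<phi> \<in> G}"

text \<open>By symmetry of \<open>feasible\<close>, the square of its support function; it is the
  value dual to the minimum over \<open>z\<close>. It is extended-valued because it is infinite off
  \<open>adj_range D L\<close>.\<close>

definition sup_sq :: "'h \<Rightarrow> ereal" where
  "sup_sq w = (SUP \<phi>\<in>feasible. ereal ((w \<bullet> \<phi>)\<^sup>2))"

lemma zero_G: "0 \<in> G"
  using zero_interior_G interior_subset by blast

lemma zero_feasible: "0 \<in> feasible"
  by (simp add: feasible_def zero_G L_0 subspace_0[OF subspace_D])

lemma uminus_feasible: "\<phi> \<in> feasible \<Longrightarrow> - \<phi> \<in> feasible"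
  using balanced_G[unfolded balanced_def, rule_format, of "-1"] subspace_D
  by (auto simp: feasible_def L_minus subspace_neg)

lemma bdd_above_support: "bdd_above ((\<lambda>f. z \<bullet> f) ` G)"
proof -
  obtain B where "\<forall>f\<in>G. norm f \<le> B" using bounded_G by (auto simp: bounded_iff)
  then show ?thesis
    by (intro bdd_aboveI2[of _ _ "norm z * B"])
      (meson mult_left_mono norm_cauchy_schwarz norm_ge_zero order_trans)
qed

lemma support_fun_upper: "f \<in> G \<Longrightarrow> z \<bullet> f \<le> support_fun G z"
  unfolding support_fun_def by (intro cSUP_upper bdd_above_support)

lemma support_fun_nonneg: "0 \<le> support_fun G z"
  using support_fun_upper[OF zero_G, of z] by simp

text \<open>Weak duality: \<open>w \<bullet> \<phi>\<close> equals
  \<open>z \<bullet> L \<phi>\<close>, and the symmetry of \<open>feasible\<close> bounds its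
  absolute value, hence its square.\<close>

lemma sup_sq_le_support:
  assumes "\<forall>\<phi>\<in>D. L \<phi> \<bullet> z = \<phi> \<bullet> w"
  shows "sup_sq w \<le> ereal ((support_fun G z)\<^sup>2)"
  unfolding sup_sq_def
proof (rule SUP_least)
  have le: "w \<bullet> \<phi> \<le> support_fun G z" if "\<phi> \<in> feasible" for \<phi>
    using support_fun_upper[of "L \<phi>" z] assms that
    by (simp add: feasible_def inner_commute)
  fix \<phi> assume \<phi>: "\<phi> \<in> feasible"
  have "\<bar>w \<bullet> \<phi>\<bar> \<le> \<bar>support_fun G z\<bar>"
    using le[OF \<phi>] le[OF uminus_feasible[OF \<phi>]] by simp
  then show "ereal ((w \<bullet> \<phi>)\<^sup>2) \<le> ereal ((support_fun G z)\<^sup>2)"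
    by (simp add: abs_le_square_iff)
qed

lemma sup_sq_nonneg: "0 \<le> sup_sq w"
  unfolding sup_sq_def by (rule SUP_upper2[OF zero_feasible]) simp

text \<open>Strong duality: the root of the finite supremum bounds \<open>w \<bullet> \<phi>\<close>
  on \<open>feasible\<close>, and the Hahn-Banach extension keeps this bound on all of
  \<open>G\<close>.\<close>

lemma adjoint_solution_sup_sq:
  assumes "sup_sq w < \<infinity>"
  obtains z where "\<forall>\<phi>\<in>D. L \<phi> \<bullet> z = \<phi> \<bullet> w" "ereal ((support_fun G z)\<^sup>2) \<le> sup_sq w"
proof -
  obtain a where a: "sup_sq w = ereal a" "0 \<le> a"
    using assms sup_sq_nonneg[of w] by (cases "sup_sq w") auto
  have "w \<bullet> \<phi> \<le> sqrt a" if "\<phi> \<in> D" "L \<phi> \<in> G" for \<phi>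
  proof -
    have "ereal ((w \<bullet> \<phi>)\<^sup>2) \<le> ereal a"
      unfolding a(1)[symmetric] sup_sq_def
      by (rule SUP_upper) (use that in \<open>simp add: feasible_def\<close>)
    then show ?thesis by (simp add: real_le_rsqrt)
  qed
  then obtain z where z: "\<And>\<phi>. \<phi> \<in> D \<Longrightarrow> L \<phi> \<bullet> z = \<phi> \<bullet> w" "\<And>g. g \<in> G \<Longrightarrow> z \<bullet> g \<le> sqrt a"
    using adjoint_equation_solution[OF linear_op convex_G zero_interior_G] by metis
  have "support_fun G z \<le> sqrt a"
    unfolding support_fun_def using z(2) zero_G by (intro cSUP_least) auto
  then have "(support_fun G z)\<^sup>2 \<le> a"
    using power_mono[OF _ support_fun_nonneg, of z "sqrt a" 2] a(2) by simp
  then show thesis by (intro that[of z]) (use z(1) a(1) in auto)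
qed

lemma min_support_sq_eq: "min_support_sq D L G w = sup_sq w"
proof (rule antisym)
  show "sup_sq w \<le> min_support_sq D L G w"
    unfolding min_support_sq_def adj_op_iff
    by (rule INF_greatest) (simp add: sup_sq_le_support)
  show "min_support_sq D L G w \<le> sup_sq w"
  proof (cases "sup_sq w = \<infinity>")
    case False
    then obtain z where "\<forall>\<phi>\<in>D. L \<phi> \<bullet> z = \<phi> \<bullet> w" "ereal ((support_fun G z)\<^sup>2) \<le> sup_sq w"
      using adjoint_solution_sup_sq by auto
    then show ?thesis
      unfolding min_support_sq_def adj_op_iff by (intro INF_lower2[of z]) auto
  qed simp
qed

lemma sup_sq_finite_iff: "sup_sq w < \<infinity> \<longleftrightarrow> w \<in> adj_range D L"
proof
  show "w \<in> adj_range D L" if "sup_sq w < \<infinity>"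
    using adjoint_solution_sup_sq[OF that] unfolding adj_range_iff by metis
  assume "w \<in> adj_range D L"
  then obtain z where "\<forall>\<phi>\<in>D. L \<phi> \<bullet> z = \<phi> \<bullet> w" unfolding adj_range_iff by blast
  then show "sup_sq w < \<infinity>" by (rule le_less_trans[OF sup_sq_le_support]) simp
qed

text \<open>The \<open>z\<close> of strong duality meets the lower bound that weak duality imposes
  on every solution.\<close>

lemma min_support_attained:
  assumes "w \<in> adj_range D L"
  shows "\<exists>z. is_arg_min (\<lambda>z. (support_fun G z)\<^sup>2) (\<lambda>z. z \<in> adj_dom D L \<and> adj_op D L z = w) z"
proof -
  obtain z where z: "\<forall>\<phi>\<in>D. L \<phi> \<bullet> z = \<phi> \<bullet> w" "ereal ((support_fun G z)\<^sup>2) \<le> sup_sq w"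
    using adjoint_solution_sup_sq assms sup_sq_finite_iff by blast
  have "(support_fun G z)\<^sup>2 \<le> (support_fun G z')\<^sup>2" if "\<forall>\<phi>\<in>D. L \<phi> \<bullet> z' = \<phi> \<bullet> w" for z'
    using order_trans[OF z(2) sup_sq_le_support[OF that]] by simp
  then show ?thesis
    using z(1) unfolding is_arg_min_linorder adj_op_iff by blast
qed

section \<open>The worst-case error of a linear estimate\<close>

lemma inner_residual: "(l - adjoint H u) \<bullet> \<phi> = l \<bullet> \<phi> - u \<bullet> H \<phi>"
  using inner_adjoint_hilbert[OF bounded_linear_H, of \<phi> u]
  by (simp add: inner_diff_left inner_diff_right inner_commute)

text \<open>Pairs one state with the extremal noise; these pairs supply the lower bound on the
  supremum.\<close>

lemma worst_mse_upper:
  assumes "\<phi> \<in> feasible"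
  shows "ereal ((l \<bullet> \<phi> - u \<bullet> H \<phi> - c)\<^sup>2 + u \<bullet> u) \<le> worst_mse D L H G l u c"
proof -
  obtain \<Omega> :: "'y measure" and \<eta> where *: "admissible_noise \<Omega> \<eta>"
    "\<And>a. prob_space.expectation \<Omega> (\<lambda>\<omega>. (a - u \<bullet> \<eta> \<omega>)\<^sup>2) = a\<^sup>2 + u \<bullet> u"
    using extremal_noise by metis
  have "l \<bullet> \<phi> - u \<bullet> (H \<phi> + \<eta> \<omega>) - c = (l \<bullet> \<phi> - u \<bullet> H \<phi> - c) - u \<bullet> \<eta> \<omega>" for \<omega>
    by (simp add: inner_add_right)
  then have "(l \<bullet> \<phi> - u \<bullet> H \<phi> - c)\<^sup>2 + u \<bullet> u
      = prob_space.expectation \<Omega> (\<lambda>\<omega>. (l \<bullet> \<phi> - u \<bullet> (H \<phi> + \<eta> \<omega>) - c)\<^sup>2)"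
    using *(2)[of "l \<bullet> \<phi> - u \<bullet> H \<phi> - c"] by presburger
  then show ?thesis
    unfolding worst_mse_def
    by (intro SUP_upper2[of "(\<phi>, \<Omega>, \<eta>)"]) (use assms *(1) in \<open>simp_all add: feasible_def\<close>)
qed

lemma sigma_err_eq: "sigma_err D L H G l u = ereal (u \<bullet> u) + sup_sq (l - adjoint H u)"
proof (rule antisym)
  have "worst_mse D L H G l u 0 \<le> ereal (u \<bullet> u) + sup_sq (l - adjoint H u)"
    unfolding worst_mse_def
  proof (rule SUP_least, clarify)
    fix \<phi> and \<Omega> :: "'y measure" and \<eta> :: "'y \<Rightarrow> 'y"
    assume *: "\<phi> \<in> D" "L \<phi> \<in> G" "admissible_noise \<Omega> \<eta>"
    have eq: "l \<bullet> \<phi> - u \<bullet> (H \<phi> + \<eta> \<omega>) - 0 = (l - adjoint H u) \<bullet> \<phi> - u \<bullet> \<eta> \<omega>" for \<omega>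
      by (simp add: inner_residual inner_add_right)
    have "ereal (prob_space.expectation \<Omega> (\<lambda>\<omega>. (l \<bullet> \<phi> - u \<bullet> (H \<phi> + \<eta> \<omega>) - 0)\<^sup>2))
        \<le> ereal (u \<bullet> u) + ereal (((l - adjoint H u) \<bullet> \<phi>)\<^sup>2)"
      unfolding eq using admissible_noise_mse[OF *(3)] by (simp add: add.commute)
    also have "\<dots> \<le> ereal (u \<bullet> u) + sup_sq (l - adjoint H u)"
      unfolding sup_sq_def using * by (intro add_left_mono SUP_upper) (simp add: feasible_def)
    finally show "ereal (prob_space.expectation \<Omega> (\<lambda>\<omega>. (l \<bullet> \<phi> - u \<bullet> (H \<phi> + \<eta> \<omega>) - 0)\<^sup>2))
        \<le> ereal (u \<bullet> u) + sup_sq (l - adjoint H u)" .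
  qed
  then show "sigma_err D L H G l u \<le> ereal (u \<bullet> u) + sup_sq (l - adjoint H u)"
    unfolding sigma_err_def by (rule INF_lower2[OF UNIV_I])
next
  have "ereal (u \<bullet> u) + sup_sq (l - adjoint H u)
      = (SUP \<phi>\<in>feasible. ereal (u \<bullet> u) + ereal (((l - adjoint H u) \<bullet> \<phi>)\<^sup>2))"
    unfolding sup_sq_def using zero_feasible by (subst SUP_ereal_add_right) auto
  also have "\<dots> \<le> worst_mse D L H G l u c" for c
  proof (rule SUP_least)
    fix \<phi> assume \<phi>: "\<phi> \<in> feasible"
    define a where "a = l \<bullet> \<phi> - u \<bullet> H \<phi>"
    have neg: "l \<bullet> (- \<phi>) - u \<bullet> H (- \<phi>) - c = - a - c"
      using linear_neg[OF bounded_linear.linear[OF bounded_linear_H], of \<phi>] by (simp add: a_def)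
    have *: "ereal ((a - c)\<^sup>2 + u \<bullet> u) \<le> worst_mse D L H G l u c"
      using worst_mse_upper[OF \<phi>, of l u c] by (simp add: a_def)
    have **: "ereal ((- a - c)\<^sup>2 + u \<bullet> u) \<le> worst_mse D L H G l u c"
      using worst_mse_upper[OF uminus_feasible[OF \<phi>], of l u c] unfolding neg .
    \<comment> \<open>The average of the two squares is \<open>a\<^sup>2 + c\<^sup>2\<close>, so
      whatever \<open>c\<close> is, one of \<open>\<phi>\<close> and \<open>- \<phi>\<close> costs
      at least as much as it would with \<open>c = 0\<close>.\<close>
    have "2 * a\<^sup>2 \<le> (a - c)\<^sup>2 + (- a - c)\<^sup>2"
      by (simp add: power2_eq_square algebra_simps)
    then have "a\<^sup>2 \<le> (a - c)\<^sup>2 \<or> a\<^sup>2 \<le> (- a - c)\<^sup>2" by linarith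
    then show "ereal (u \<bullet> u) + ereal (((l - adjoint H u) \<bullet> \<phi>)\<^sup>2) \<le> worst_mse D L H G l u c"
      unfolding inner_residual a_def[symmetric]
      using order_trans[OF _ *] order_trans[OF _ **] by fastforce
  qed
  finally show "ereal (u \<bullet> u) + sup_sq (l - adjoint H u) \<le> sigma_err D L H G l u"
    unfolding sigma_err_def by (rule INF_greatest)
qed

text \<open>A sublevel set is cut out by quadratic inequalities in \<open>u\<close>, so convexity,
  closedness and boundedness can be checked for one \<open>\<phi>\<close> at a time.\<close>

lemma sigma_err_le_iff:
  "sigma_err D L H G l u \<le> ereal t \<longleftrightarrow> (\<forall>\<phi>\<in>feasible. u \<bullet> u + (l \<bullet> \<phi> - u \<bullet> H \<phi>)\<^sup>2 \<le> t)"
proof -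
  have "ereal (u \<bullet> u) + sup_sq (l - adjoint H u)
      = (SUP \<phi>\<in>feasible. ereal (u \<bullet> u + (l \<bullet> \<phi> - u \<bullet> H \<phi>)\<^sup>2))"
    unfolding sup_sq_def using zero_feasible
    by (subst SUP_ereal_add_right[symmetric]) (auto simp: inner_residual)
  then show ?thesis unfolding sigma_err_eq by (simp add: SUP_le_iff)
qed

lemma sigma_err_finite_iff: "sigma_err D L H G l u < \<infinity> \<longleftrightarrow> l - adjoint H u \<in> adj_range D L"
  unfolding sigma_err_eq sup_sq_finite_iff[symmetric] by simp

lemma minimax_error_finite_iff:
  "minimax_error D L H G l < \<infinity> \<longleftrightarrow> (\<exists>u. l - adjoint H u \<in> adj_range D L)"
proof -
  have "minimax_error D L H G l < \<infinity> \<longleftrightarrow> (INF u. sigma_err D L H G l u) < \<infinity>"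
    unfolding minimax_error_def Let_def by simp
  then show ?thesis by (simp only: INF_less_iff sigma_err_finite_iff) simp
qed

section \<open>Existence and uniqueness of the minimax estimation\<close>

lemma minimax_estimation_iff:
  "minimax_estimation D L H G l u \<longleftrightarrow> (\<forall>v. sigma_err D L H G l u \<le> sigma_err D L H G l v)"
  unfolding minimax_estimation_def is_arg_min_linorder by simp

text \<open>Strong convexity: the gap comes from the parallelogram law for
  \<open>u \<bullet> u\<close>, while the squared residual is convex.\<close>

lemma sigma_err_midpoint:
  assumes "sigma_err D L H G l u \<le> ereal t" "sigma_err D L H G l v \<le> ereal t"
  shows "sigma_err D L H G l ((1/2) *\<^sub>R (u + v)) \<le> ereal (t - (norm (u - v))\<^sup>2 / 4)"
  unfolding sigma_err_le_iff
proof
  fix \<phi> assume \<phi>: "\<phi> \<in> feasible"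
  let ?m = "(1/2) *\<^sub>R (u + v)"
  define a b where "a = l \<bullet> \<phi> - u \<bullet> H \<phi>" and "b = l \<bullet> \<phi> - v \<bullet> H \<phi>"
  have ab: "l \<bullet> \<phi> - ?m \<bullet> H \<phi> = (a + b) / 2"
    by (simp add: a_def b_def inner_add_left field_simps)
  have "4 * (?m \<bullet> ?m) + (norm (u - v))\<^sup>2 = 2 * (u \<bullet> u) + 2 * (v \<bullet> v)"
    by (simp add: power2_norm_eq_inner algebra_simps)
  moreover have "4 * ((a + b) / 2)\<^sup>2 \<le> 2 * a\<^sup>2 + 2 * b\<^sup>2"
    using zero_le_power2[of "a - b"] by (simp add: power2_eq_square algebra_simps)
  moreover have "u \<bullet> u + a\<^sup>2 \<le> t" "v \<bullet> v + b\<^sup>2 \<le> t"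
    using assms \<phi> unfolding sigma_err_le_iff a_def b_def by auto
  ultimately show "?m \<bullet> ?m + (l \<bullet> \<phi> - ?m \<bullet> H \<phi>)\<^sup>2 \<le> t - (norm (u - v))\<^sup>2 / 4"
    unfolding ab by argo
qed

lemma convex_sigma_err_sublevel: "convex {u. sigma_err D L H G l u \<le> ereal t}"
proof (rule convexI)
  fix u v and r s :: real
  assume h: "u \<in> {u. sigma_err D L H G l u \<le> ereal t}"
    "v \<in> {u. sigma_err D L H G l u \<le> ereal t}" "0 \<le> r" "0 \<le> s" "r + s = 1"
  have "(r *\<^sub>R u + s *\<^sub>R v) \<bullet> (r *\<^sub>R u + s *\<^sub>R v)
      + (l \<bullet> \<phi> - (r *\<^sub>R u + s *\<^sub>R v) \<bullet> H \<phi>)\<^sup>2 \<le> t" if \<phi>: "\<phi> \<in> feasible" for \<phi>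
  proof -
    define a b where "a = l \<bullet> \<phi> - u \<bullet> H \<phi>" and "b = l \<bullet> \<phi> - v \<bullet> H \<phi>"
    have s: "s = 1 - r" using h by simp
    have "l \<bullet> \<phi> - (r *\<^sub>R u + s *\<^sub>R v) \<bullet> H \<phi> = r * a + s * b"
      by (simp add: a_def b_def s algebra_simps)
    moreover have "(r * a + s * b)\<^sup>2 \<le> r * a\<^sup>2 + s * b\<^sup>2"
      using h by (intro square_convex_combination_le)
    moreover have "(r *\<^sub>R u + s *\<^sub>R v) \<bullet> (r *\<^sub>R u + s *\<^sub>R v)
        = r * (u \<bullet> u) + s * (v \<bullet> v) - r * s * ((u - v) \<bullet> (u - v))"
      by (simp add: s algebra_simps inner_commute)
    moreover have "0 \<le> r * s * ((u - v) \<bullet> (u - v))"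
      using h by auto
    moreover have "r * (u \<bullet> u + a\<^sup>2) + s * (v \<bullet> v + b\<^sup>2) \<le> r * t + s * t"
      using h \<phi> unfolding mem_Collect_eq sigma_err_le_iff a_def b_def
      by (intro add_mono mult_left_mono) auto
    moreover have "r * t + s * t = t" by (simp add: s algebra_simps)
    ultimately show ?thesis by (simp add: algebra_simps)
  qed
  then show "r *\<^sub>R u + s *\<^sub>R v \<in> {u. sigma_err D L H G l u \<le> ereal t}"
    by (simp add: sigma_err_le_iff)
qed

lemma closed_sigma_err_sublevel: "closed {u. sigma_err D L H G l u \<le> ereal t}"
  unfolding sigma_err_le_iff Ball_def
  by (intro closed_Collect_all closed_Collect_imp closed_Collect_le continuous_intros) auto

lemma bounded_sigma_err_sublevel: "bounded {u. sigma_err D L H G l u \<le> ereal t}"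
proof (rule boundedI)
  fix u assume "u \<in> {u. sigma_err D L H G l u \<le> ereal t}"
  then have "u \<bullet> u \<le> t" using zero_feasible unfolding mem_Collect_eq sigma_err_le_iff
    by (fastforce simp: add_nonneg_nonneg intro: order_trans[rotated])
  then show "norm u \<le> sqrt t" by (simp add: norm_eq_sqrt_inner)
qed

lemma ex1_minimax_estimation:
  assumes "\<exists>u. l - adjoint H u \<in> adj_range D L"
  shows "\<exists>!u. minimax_estimation D L H G l u"
proof -
  let ?\<sigma> = "sigma_err D L H G l"
  have nonneg: "0 \<le> ?\<sigma> u" for u
    unfolding sigma_err_eq using sup_sq_nonneg by (simp add: add_nonneg_nonneg)
  have "(INF u. ?\<sigma> u) < \<infinity>"
    using assms by (simp only: INF_less_iff sigma_err_finite_iff) simp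
  moreover have "0 \<le> (INF u. ?\<sigma> u)" by (rule INF_greatest) (rule nonneg)
  ultimately obtain m where m: "(INF u. ?\<sigma> u) = ereal m"
    by (cases "INF u. ?\<sigma> u") auto
  have lower: "ereal m \<le> ?\<sigma> u" for u
    unfolding m[symmetric] by (rule INF_lower) simp
  \<comment> \<open>Sublevel sets at levels decreasing to the infimum \<open>m\<close>; a common
    point is a minimiser.\<close>
  define C where "C n = {u. ?\<sigma> u \<le> ereal (m + inverse (real (Suc n)))}" for n
  have "(\<Inter>n. C n) \<noteq> {}"
  proof (rule nested_closed_convex_Inter_nonempty)
    show "closed (C n)" "convex (C n)" "bounded (C 0)" for n
      unfolding C_def
      by (rule closed_sigma_err_sublevel convex_sigma_err_sublevel bounded_sigma_err_sublevel)+
    show "C n \<noteq> {}" for n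
    proof -
      have "(INF u. ?\<sigma> u) < ereal (m + inverse (real (Suc n)))" by (simp add: m)
      then show ?thesis unfolding INF_less_iff C_def by (auto intro: less_imp_le)
    qed
    show "decseq C"
    proof -
      have "m + inverse (real (Suc n)) \<le> m + inverse (real (Suc k))" if "k \<le> n" for k n
        using that by (intro add_left_mono le_imp_inverse_le) auto
      then show ?thesis
        unfolding decseq_def C_def by (fastforce intro: order_trans)
    qed
  qed
  then obtain u where u: "\<And>n. u \<in> C n" by blast
  have "?\<sigma> u \<le> ereal m"
  proof (rule LIMSEQ_le_const)
    show "(\<lambda>n. ereal (m + inverse (real (Suc n)))) \<longlonglongrightarrow> ereal m"
      by (intro tendsto_ereal LIMSEQ_inverse_real_of_nat_add)
    show "\<exists>N. \<forall>n\<ge>N. ?\<sigma> u \<le> ereal (m + inverse (real (Suc n)))"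
      using u unfolding C_def by simp
  qed
  then have min_iff: "minimax_estimation D L H G l v \<longleftrightarrow> ?\<sigma> v \<le> ereal m" for v
    unfolding minimax_estimation_iff using lower order_trans by meson
  \<comment> \<open>Two distinct minimisers would have a midpoint with error below
    \<open>m\<close>.\<close>
  have "v = u" if "?\<sigma> v \<le> ereal m" for v
  proof -
    have "ereal m \<le> ereal (m - (norm (u - v))\<^sup>2 / 4)"
      using lower sigma_err_midpoint[OF \<open>?\<sigma> u \<le> ereal m\<close> that] order_trans by blast
    then show ?thesis by simp
  qed
  with \<open>?\<sigma> u \<le> ereal m\<close> show ?thesis unfolding min_iff by blast
qed

end

section \<open>Optimality condition\<close>

context minimax_problem
begin

lemma I2_eq: "I2 D L G l w = sup_sq (orth_proj (adj_range D L) (l - w))"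
  unfolding I2_def min_support_sq_eq ..

text \<open>The projection fixes \<open>adj_range D L\<close>, so for an admissible weight
  \<open>u\<close> the error is \<open>u \<bullet> u\<close> plus \<open>I2\<close> at
  \<open>adjoint H u\<close>.\<close>

lemma I2_eq_on_adj_range:
  assumes "l - w \<in> adj_range D L"
  shows "I2 D L G l w = sup_sq (l - w)"
  using orth_proj_eqI[OF subspace_adj_range assms, of "l - w"] by (simp add: I2_eq)

lemma sup_sq_le_iff: "sup_sq w \<le> ereal t \<longleftrightarrow> (\<forall>\<phi>\<in>feasible. (w \<bullet> \<phi>)\<^sup>2 \<le> t)"
  unfolding sup_sq_def by (simp add: SUP_le_iff)

text \<open>Admissibility becomes a system of linear equations in \<open>u\<close>: the directions
  that preserve it are those orthogonal to \<open>H\<close> applied to the null space.\<close>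

lemma residual_in_adj_range_iff:
  assumes "closed (L ` D)"
  shows "l - adjoint H u \<in> adj_range D L \<longleftrightarrow> (\<forall>n \<in> null_space D L. l \<bullet> n = u \<bullet> H n)"
  unfolding closed_range_adjoint[OF assms] by (simp add: inner_residual)

lemma minimax_estimation_imp_admissible:
  assumes "\<exists>u. l - adjoint H u \<in> adj_range D L" "minimax_estimation D L H G l u"
  shows "l - adjoint H u \<in> adj_range D L"
  using assms unfolding minimax_estimation_iff sigma_err_finite_iff[symmetric]
  by (meson le_less_trans)

text \<open>The subgradient inequality at \<open>adjoint H v\<close> offsets the first-order change
  of \<open>v \<bullet> v\<close>, so the error grows at least by the squared norm of
  \<open>v - u\<close>.\<close>

lemma optimality_condition_sufficient:
  assumes u: "l - adjoint H u \<in> adj_range D L" and opt: "optimality_condition D L H G l u p"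
  shows "minimax_estimation D L H G l u"
  unfolding minimax_estimation_iff
proof
  fix v
  obtain q where q: "H q = - 2 *\<^sub>R (u - H p)" "q \<in> subdifferential (I2 D L G l) (adjoint H u)"
    and p: "p \<in> null_space D L"
    using opt unfolding optimality_condition_def null_space_def by auto
  show "sigma_err D L H G l u \<le> sigma_err D L H G l v"
  proof (cases "l - adjoint H v \<in> adj_range D L")
    case False
    then have "sigma_err D L H G l v = \<infinity>" by (simp add: sigma_err_finite_iff[symmetric])
    then show ?thesis by simp
  next
    case v: True
    obtain a b where ab: "sup_sq (l - adjoint H u) = ereal a" "sup_sq (l - adjoint H v) = ereal b"
      using u v sup_sq_nonneg unfolding sup_sq_finite_iff[symmetric]
      by (metis ereal_cases less_irrefl not_less ereal_infty_less_eq(2) ereal_less_eq(2) MInfty_neq_ereal(1) zero_ereal_def)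
    have "I2 D L G l (adjoint H u) + ereal (q \<bullet> (adjoint H v - adjoint H u))
        \<le> I2 D L G l (adjoint H v)"
      using q(2) unfolding subdifferential_def by blast
    then have "a + q \<bullet> (adjoint H v - adjoint H u) \<le> b"
      by (simp add: I2_eq_on_adj_range u v ab)
    also have "q \<bullet> (adjoint H v - adjoint H u) = H q \<bullet> (v - u)"
      by (simp add: inner_diff_right inner_adjoint_hilbert[OF bounded_linear_H])
    also have "\<dots> = - 2 * (u \<bullet> (v - u)) + 2 * (H p \<bullet> (v - u))"
      by (simp add: q(1) inner_diff_left algebra_simps)
    \<comment> \<open>Both residuals are orthogonal to \<open>p\<close>, hence so is their
      difference, which is \<open>adjoint H (v - u)\<close>.\<close>
    also have "H p \<bullet> (v - u) = 0"
      using adj_range_orth_null_space[OF u p] adj_range_orth_null_space[OF v p]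
      by (simp add: inner_residual inner_diff_right inner_commute[of "H p"])
    finally have "a - 2 * (u \<bullet> (v - u)) \<le> b" by simp
    moreover have "v \<bullet> v = u \<bullet> u + 2 * (u \<bullet> (v - u)) + (v - u) \<bullet> (v - u)"
      by (simp add: algebra_simps inner_commute)
    ultimately have "u \<bullet> u + a \<le> v \<bullet> v + b" by (smt (verit) inner_ge_zero)
    then show ?thesis by (simp add: sigma_err_eq ab)
  qed
qed

text \<open>Makes \<open>I2\<close> finite and bounded on bounded sets. The projected vector is
  orthogonal to the null space, so \<open>\<phi>\<close> can be exchanged for a preimage of norm at
  most \<open>K * B\<close>.\<close>

lemma orth_proj_adj_range_bound:
  assumes "closed (L ` D)"
  obtains M where "\<And>w. sup_sq (orth_proj (adj_range D L) w) \<le> ereal ((norm w * M)\<^sup>2)" "0 \<le> M"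
proof -
  let ?P = "orth_proj (adj_range D L)"
  note S = subspace_adj_range closed_adj_range[OF assms]
  obtain K where K: "0 \<le> K"
    "\<And>\<phi>. \<phi> \<in> D \<Longrightarrow> \<exists>\<psi>\<in>D. L \<psi> = L \<phi> \<and> norm \<psi> \<le> K * norm (L \<phi>)"
    using bounded_preimage_of_closed_range[OF assms] by blast
  obtain B where B: "0 \<le> B" "\<And>g. g \<in> G \<Longrightarrow> norm g \<le> B"
    using bounded_G by (meson bounded_pos less_imp_le)
  show thesis
  proof (rule that[of "K * B"])
    fix w
    show "sup_sq (?P w) \<le> ereal ((norm w * (K * B))\<^sup>2)"
      unfolding sup_sq_le_iff
    proof
      fix \<phi> assume "\<phi> \<in> feasible"
      then have \<phi>: "\<phi> \<in> D" "L \<phi> \<in> G" by (auto simp: feasible_def)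
      then obtain \<psi> where \<psi>: "\<psi> \<in> D" "L \<psi> = L \<phi>" "norm \<psi> \<le> K * norm (L \<phi>)"
        using K(2) by blast
      have "\<phi> - \<psi> \<in> null_space D L"
        using \<phi> \<psi> subspace_D by (simp add: null_space_def L_diff subspace_diff)
      from adj_range_orth_null_space[OF orth_proj_hilbert(1)[OF S] this]
      have "?P w \<bullet> \<phi> = ?P w \<bullet> \<psi>" by (simp add: inner_diff_right)
      then have "\<bar>?P w \<bullet> \<phi>\<bar> \<le> norm (?P w) * norm \<psi>" by (simp add: Cauchy_Schwarz_ineq2)
      also have "\<dots> \<le> norm w * (K * B)"
        using \<psi>(3) B(2)[OF \<phi>(2)] K(1)
        by (intro mult_mono norm_orth_proj_le[OF S] order_trans[OF \<psi>(3)] mult_left_mono) auto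
      finally show "(?P w \<bullet> \<phi>)\<^sup>2 \<le> (norm w * (K * B))\<^sup>2"
        by (rule power2_le_iff_abs_le[THEN iffD2, rotated]) (use K B in simp)
    qed
  qed (use K B in simp)
qed

lemma optimality_condition_necessary:
  assumes cl: "closed (L ` D)" "closed (H ` null_space D L)"
    and u: "l - adjoint H u \<in> adj_range D L" and min: "minimax_estimation D L H G l u"
  shows "\<exists>p. optimality_condition D L H G l u p"
proof -
  let ?A = "adjoint H" and ?P = "orth_proj (adj_range D L)"
  note S = subspace_adj_range closed_adj_range[OF cl(1)]
  interpret H: bounded_linear H by (rule bounded_linear_H)
  interpret A: linear ?A by (rule linear_adjoint_hilbert[OF bounded_linear_H])
  obtain M where M: "\<And>w. sup_sq (?P w) \<le> ereal ((norm w * M)\<^sup>2)" "0 \<le> M"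
    using orth_proj_adj_range_bound[OF cl(1)] by blast
  have "\<exists>a. I2 D L G l w = ereal a \<and> 0 \<le> a" for w
    using M(1)[of "l - w"] sup_sq_nonneg[of "?P (l - w)"] unfolding I2_eq
    by (cases "sup_sq (?P (l - w))") auto
  then obtain F where F: "\<And>w. I2 D L G l w = ereal (F w)" "\<And>w. 0 \<le> F w" by metis
  have F_le_iff: "F w \<le> t \<longleftrightarrow> (\<forall>\<phi>\<in>feasible. (?P (l - w) \<bullet> \<phi>)\<^sup>2 \<le> t)" for w t
    using sup_sq_le_iff[of "?P (l - w)" t] by (simp add: I2_eq[symmetric] F)
  have sigma: "sigma_err D L H G l v = ereal (v \<bullet> v + F (?A v))" if "l - ?A v \<in> adj_range D L" for v
    unfolding sigma_err_eq I2_eq_on_adj_range[OF that, symmetric] F by simp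
  \<comment> \<open>Epigraph of the increment of \<open>I2\<close> at \<open>adjoint H u\<close>,
    with \<open>F\<close> the real-valued form of \<open>I2\<close>.\<close>
  define E where "E = {(x, s). F (?A u + x) \<le> s + F (?A u)}"
  \<comment> \<open>The directions in which \<open>u\<close> can move and stay admissible.\<close>
  define V where "V = {v. \<forall>n \<in> null_space D L. v \<bullet> H n = 0}"
  have "convex E"
  proof (rule convexI)
    fix e e' and r t :: real
    assume h: "e \<in> E" "e' \<in> E" "0 \<le> r" "0 \<le> t" "r + t = 1"
    obtain x s x' s' where e: "e = (x, s)" "e' = (x', s')" by fastforce
    have "F (?A u + (r *\<^sub>R x + t *\<^sub>R x')) \<le> r * s + t * s' + F (?A u)"
      unfolding F_le_iff
    proof
      fix \<phi> assume \<phi>: "\<phi> \<in> feasible"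
      define a b where "a = ?P (l - (?A u + x)) \<bullet> \<phi>" and "b = ?P (l - (?A u + x')) \<bullet> \<phi>"
      have t: "t = 1 - r" using h by simp
      have "l - (?A u + (r *\<^sub>R x + t *\<^sub>R x')) = r *\<^sub>R (l - (?A u + x)) + t *\<^sub>R (l - (?A u + x'))"
        by (simp add: t algebra_simps)
      then have "?P (l - (?A u + (r *\<^sub>R x + t *\<^sub>R x'))) \<bullet> \<phi> = r * a + t * b"
        by (simp add: orth_proj_linear_combination[OF S] inner_add_left a_def b_def)
      moreover have "(r * a + t * b)\<^sup>2 \<le> r * a\<^sup>2 + t * b\<^sup>2"
        using h by (intro square_convex_combination_le)
      moreover have "r * a\<^sup>2 + t * b\<^sup>2 \<le> r * (s + F (?A u)) + t * (s' + F (?A u))"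
        using h \<phi> unfolding E_def e F_le_iff a_def b_def
        by (intro add_mono mult_left_mono) auto
      moreover have "r * (s + F (?A u)) + t * (s' + F (?A u)) = r * s + t * s' + F (?A u)"
        by (simp add: t algebra_simps)
      ultimately show "(?P (l - (?A u + (r *\<^sub>R x + t *\<^sub>R x'))) \<bullet> \<phi>)\<^sup>2 \<le> r * s + t * s' + F (?A u)"
        by simp
    qed
    then show "r *\<^sub>R e + t *\<^sub>R e' \<in> E" by (simp add: E_def e)
  qed
  \<comment> \<open>Bounds \<open>F\<close> on the unit ball around \<open>adjoint H u\<close>,
    which gives \<open>E\<close> interior points above 0.\<close>
  define B where "B = ((norm (l - ?A u) + 1) * M)\<^sup>2"
  have "(0, B + 1) \<in> interior E"
  proof (rule interiorI)
    show "open (ball (0::'h) 1 \<times> {B<..})" by (intro open_Times) auto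
    show "ball 0 1 \<times> {B<..} \<subseteq> E"
    proof clarify
      fix x :: 'h and s assume x: "x \<in> ball 0 1" and s: "B < s"
      have "norm (l - ?A u - x) \<le> norm (l - ?A u) + norm x" by (rule norm_triangle_ineq4)
      then have "norm (l - (?A u + x)) \<le> norm (l - ?A u) + 1"
        using x by (simp add: diff_diff_eq)
      then have "(norm (l - (?A u + x)) * M)\<^sup>2 \<le> B"
        unfolding B_def using M(2) by (intro power_mono mult_right_mono) auto
      moreover have "F (?A u + x) \<le> (norm (l - (?A u + x)) * M)\<^sup>2"
        using M(1)[of "l - (?A u + x)"] by (simp add: I2_eq[symmetric] F)
      ultimately show "(x, s) \<in> E" using s F(2)[of "?A u"] by (simp add: E_def)
    qed
  qed auto
  moreover have "0 < B + 1" by (simp add: B_def add_nonneg_pos)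
  moreover have "subspace V"
    unfolding V_def by (auto simp: subspace_def inner_add_left)
  then have "linear_operator_on V ?A" "linear_operator_on V (\<lambda>v. - 2 * (u \<bullet> v))"
    by (auto simp: linear_operator_on_def A.add A.scale inner_add_right algebra_simps)
  moreover have "- 2 * (u \<bullet> v) \<le> s" if v: "v \<in> V" "(?A v, s) \<in> E" for v s
  proof (rule ccontr)
    assume neg: "\<not> ?thesis"
    define \<delta> where "\<delta> = - (2 * (u \<bullet> v) + s)"
    have \<delta>: "0 < \<delta>" using neg by (simp add: \<delta>_def)
    \<comment> \<open>Small enough that the quadratic term \<open>t * t * (v \<bullet> v)\<close> is
      less than the first-order gain \<open>t * \<delta>\<close>, and at most 1 so that convexity of
      \<open>E\<close> applies.\<close>
    define t where "t = \<delta> / (\<delta> + v \<bullet> v)"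
    have t: "0 < t" "t \<le> 1" using \<delta> by (auto simp: t_def add_pos_nonneg)
    have "(0, 0) \<in> E" by (simp add: E_def)
    then have "t *\<^sub>R (?A v, s) + (1 - t) *\<^sub>R (0, 0) \<in> E"
      using t v by (intro convexD[OF \<open>convex E\<close>]) auto
    then have F_le: "F (?A (u + t *\<^sub>R v)) \<le> t * s + F (?A u)"
      by (simp add: E_def A.add A.scale)
    have adm: "l - ?A (u + t *\<^sub>R v) \<in> adj_range D L"
      using u v(1) unfolding residual_in_adj_range_iff[OF cl(1)] V_def
      by (simp add: inner_add_left)
    have "sigma_err D L H G l u \<le> sigma_err D L H G l (u + t *\<^sub>R v)"
      using min unfolding minimax_estimation_iff by blast
    then have "u \<bullet> u + F (?A u) \<le> (u + t *\<^sub>R v) \<bullet> (u + t *\<^sub>R v) + F (?A (u + t *\<^sub>R v))"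
      unfolding sigma[OF u] sigma[OF adm] by simp
    also have "(u + t *\<^sub>R v) \<bullet> (u + t *\<^sub>R v) = u \<bullet> u + t * (2 * (u \<bullet> v) + t * (v \<bullet> v))"
      by (simp add: algebra_simps inner_commute)
    finally have "0 \<le> t * s + t * (2 * (u \<bullet> v) + t * (v \<bullet> v))"
      using F_le by simp
    then have "0 \<le> t * (t * (v \<bullet> v) - \<delta>)"
      by (simp add: \<delta>_def algebra_simps)
    then have "\<delta> \<le> t * (v \<bullet> v)" using t by (simp add: zero_le_mult_iff)
    moreover have "\<delta> + v \<bullet> v > 0" using \<delta> by (simp add: add_pos_nonneg)
    then have "t * (v \<bullet> v) = \<delta> - t * \<delta>"
      by (simp add: t_def field_simps)
    ultimately show False using mult_pos_pos[OF t(1) \<delta>] by simp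
  qed
  ultimately obtain q where q: "\<And>v. v \<in> V \<Longrightarrow> q \<bullet> ?A v = - 2 * (u \<bullet> v)"
    "\<And>x s. (x, s) \<in> E \<Longrightarrow> q \<bullet> x \<le> s"
    using sandwich_functional_hilbert[OF _ _ \<open>convex E\<close>, of V ?A "\<lambda>v. - 2 * (u \<bullet> v)" "B + 1"]
    by blast
  have "F (?A u) + q \<bullet> (y - ?A u) \<le> F y" for y
    using q(2)[of "y - ?A u" "F y - F (?A u)"] by (simp add: E_def)
  then have sub: "q \<in> subdifferential (I2 D L G l) (?A u)"
    by (simp add: subdifferential_def F)
  have "H q + 2 *\<^sub>R u \<in> H ` null_space D L"
  proof (rule double_orth_complement[OF _ cl(2)])
    show "subspace (H ` null_space D L)"
      by (rule linear_subspace_image[OF H.linear subspace_null_space])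
    fix v assume "\<And>s. s \<in> H ` null_space D L \<Longrightarrow> v \<bullet> s = 0"
    then have "v \<in> V" by (auto simp: V_def)
    from q(1)[OF this] show "(H q + 2 *\<^sub>R u) \<bullet> v = 0"
      by (simp add: inner_add_left inner_adjoint_hilbert[OF bounded_linear_H])
  qed
  then obtain n where n: "n \<in> null_space D L" "H q + 2 *\<^sub>R u = H n" by auto
  \<comment> \<open>Halving \<open>n\<close> absorbs the factor 2 from the gradient of
    \<open>u \<bullet> u\<close>.\<close>
  have "(1/2) *\<^sub>R n \<in> null_space D L"
    using subspace_null_space n(1) by (rule subspace_scale)
  moreover have "- 2 *\<^sub>R (u - H ((1/2) *\<^sub>R n)) = H q"
    using n(2) by (simp add: H.scaleR algebra_simps)
  ultimately have "optimality_condition D L H G l u ((1/2) *\<^sub>R n)"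
    using sub unfolding optimality_condition_def null_space_def by (auto intro: image_eqI)
  then show ?thesis ..
qed

end

theorem mainTheorem1:
  fixes D :: "'h::{real_inner, complete_space} set"
    and L :: "'h \<Rightarrow> 'f::{real_inner, complete_space}"
    and H :: "'h \<Rightarrow> 'y::{real_inner, complete_space}"
    and G :: "'f set"
    and l :: 'h
  assumes "closed_operator_on D L" and "closure D = UNIV"
    and "bounded_linear H"
    and "convex G" and "bounded G" and "closed G" and "balanced G" and "0 \<in> interior G"
  shows
    "(minimax_error D L H G l < \<infinity> \<longleftrightarrow> (\<exists>u. l - adjoint H u \<in> adj_range D L)) \<and>
     ((\<exists>u. l - adjoint H u \<in> adj_range D L) \<longrightarrow>
        (\<exists>!u. minimax_estimation D L H G l u) \<and>
        (\<forall>u. minimax_estimation D L H G l u \<longrightarrow>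
           u \<in> admissible_weights D L H l \<and>
           sigma_err D L H G l u = (INF v. sigma_err D L H G l v)) \<and>
        (\<forall>u. sigma_err D L H G l u =
           ereal (u \<bullet> u) + min_support_sq D L G (l - adjoint H u)) \<and>
        (\<forall>w \<in> adj_range D L. \<exists>z.
           is_arg_min (\<lambda>z. (support_fun G z)\<^sup>2) (\<lambda>z. z \<in> adj_dom D L \<and> adj_op D L z = w) z) \<and>
        (closed (L ` D) \<and> closed (H ` null_space D L) \<longrightarrow>
           (\<forall>u. minimax_estimation D L H G l u \<longleftrightarrow>
              u \<in> admissible_weights D L H l \<and>
              (\<exists>p\<^sub>0. optimality_condition D L H G l u p\<^sub>0))))"
proof -
  interpret minimax_problem D L H G
    using assms
    by (intro minimax_problem.intro closed_dense_operator.intro minimax_problem_axioms.intro)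
  have INF_eq: "sigma_err D L H G l u = (INF v. sigma_err D L H G l v)"
    if "minimax_estimation D L H G l u" for u
    using that unfolding minimax_estimation_iff by (intro antisym INF_greatest INF_lower) auto
  have mem: "u \<in> admissible_weights D L H l \<longleftrightarrow> l - adjoint H u \<in> adj_range D L" for u
    by (simp add: admissible_weights_def)
  show ?thesis
    unfolding mem
  proof (intro conjI impI allI ballI)
    assume ex: "\<exists>u. l - adjoint H u \<in> adj_range D L"
    show "\<exists>!u. minimax_estimation D L H G l u"
      by (rule ex1_minimax_estimation[OF ex])
    show "l - adjoint H u \<in> adj_range D L" if "minimax_estimation D L H G l u" for u
      by (rule minimax_estimation_imp_admissible[OF ex that])
    show "minimax_estimation D L H G l u \<longleftrightarrow> l - adjoint H u \<in> adj_range D L \<and>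
        (\<exists>p\<^sub>0. optimality_condition D L H G l u p\<^sub>0)"
      if "closed (L ` D) \<and> closed (H ` null_space D L)" for u
      using that minimax_estimation_imp_admissible[OF ex] optimality_condition_necessary
        optimality_condition_sufficient by blast
    show "sigma_err D L H G l u = ereal (u \<bullet> u) + min_support_sq D L G (l - adjoint H u)" for u
      by (simp only: sigma_err_eq min_support_sq_eq)
  qed (rule minimax_error_finite_iff INF_eq min_support_attained; assumption?)+
qed

end
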